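(* Let $X$ be a set, let $M(X)$ be the free monoid generated by $X$ (product written as concatenation), let $E$ be the edge set of a quiver with vertex set $M(X)$, put $Q=(M(X),E)$, and let $R$ be a set of morphisms of the free linear monoidal category $\mathscr{M}Q$. Suppose the linear monoidal category $\mathcal{M}$ has the presentation $(X,E,R)_\otimes$ as a linear monoidal category. Then $\mathcal{M}$ has the presentation $(M(X),\bar E,\bar R)$ as a linear category, where $\bar E$ and $\bar R$ are defined as follows. (1) $\bar E=\{(v,e,w)\mid v,w\in M(X),\ e\in E\}$, where for $e\colon x\to y$ in $E$ the triple $(v,e,w)$ is an edge from $vxw$ to $vyw$. Put $\bar Q=(M(X),\bar E)$. (2) $\bar R=C\cup R'$, a set of morphisms of the free linear category $\mathscr{L}\bar Q$, where: (i) $C$ consists of all morphisms $$(v,e,wv'y'w')\circ(vxwv',e',w')-(vywv',e',w')\circ(v,e,wv'x'w')$$ with $v,w,v',w'\in M(X)$ and $e\colon x\to y$, $e'\colon x'\to y'$ in $E$; (ii) $R'$ is constructed as follows. For each relation in $R$, written (by choosing a representative $r$ in $\mathscr{L}\bar Q$) as $$[r]=\sum_{i=1}^n k_i[f_i],\qquad f_i=\alpha^i_1\circ\dots\circ\alpha^i_{n_i},\qquad \alpha^i_j=(v^i_j,e^i_j,w^i_j),$$ with $n,n_i\in\mathbb{N}$, $k_i\in\Bbbk$, $e^i_j\in E$, $v^i_j,w^i_j\in M(X)$, the set $R'$ contains, for all $a,b\in M(X)$, the morphism $$r_{a,b}=\sum_{i=1}^n k_i (f_i)_{a,b},\qquad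 (f_i)_{a,b}=(\alpha^i_1)_{a,b}\circ\dots\circ(\alpha^i_{n_i})_{a,b},\qquad (\alpha^i_j)_{a,b}=(av^i_j,e^i_j,w^i_jb),$$ and $R'$ consists exactly of these morphisms.
   Context: $\Bbbk$ is a fixed commutative ground ring; all linear categories are small and $\Bbbk$-linear; all monoidal categories are strict. A quiver $Q=(V,E)$ is a set $V$ of vertices and a set $E$ of edges with start and end maps $\partial_0,\partial_1\colon E\to V$; write $e\colon a\to b$ if $\partial_0e=a$, $\partial_1e=b$. A path on $Q$ is a morphism of the free category on $Q$: a formal finite composition of composable edges, or a trivial path $1_v$, $v\in V$. A linear category is a category whose hom-sets are $\Bbbk$-modules and whose composition is bilinear. The free linear category $\mathscr{L}Q$ over $Q$ has object set $V$, and $\mathscr{L}Q(a,b)$ is the free $\Bbbk$-module on the paths from $a$ to $b$, with composition extended bilinearly. An ideal $\mathcal{I}$ of a linear category $\mathcal{L}$ is a family of submodules $\mathcal{I}(a,b)\subseteq\mathcal{L}(a,b)$, for all objects $a,b$, such that $g\circ f$ lies in $\mathcal{I}$ whenever $f$ and $g$ are composable morphisms of $\mathcal{L}$ and at least one of them lies in $\mathcal{I}$. For a set $S$ of morphisms, $\langle S\rangle$ is the smallest ideal containing $S$. The quotient category $\mathcal{L}/\mathcal{I}$ has the same objects and hom-modules $\mathcal{L}(a,b)/\mathcal{I}(a,b)$. A presentation of a linear category $\mathcal{C}$ is a triple $(V,E,R)$ with $(V,E)$ a quiver and $R$ a set of morphisms of $\mathscr{L}(V,E)$ such that $\mathcal{C}$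 is isomorphic, as a linear category, to $\mathscr{L}(V,E)/\langle R\rangle$. A (strict) linear monoidal category is a linear category with a bilinear bifunctor $\otimes$ which is strictly associative on objects and morphisms and has a strict unit object $\mathbb{1}$. A linear monoidal functor is a linear functor strictly preserving $\otimes$ and $\mathbb{1}$. A monoidal quiver is a quiver whose vertex set is a monoid; a morphism of monoidal quivers is a pair of maps on vertices and edges compatible with $\partial_0,\partial_1$ such that the map on vertices is a monoid morphism. Each linear monoidal category $\mathcal{D}$ has an underlying monoidal quiver $U\mathcal{D}$ (vertices: objects; edges: all morphisms). The free linear monoidal category $\mathscr{M}Q$ over a monoidal quiver $Q$, with a morphism of monoidal quivers $\tau\colon Q\to U\mathscr{M}Q$, is characterized by: for every linear monoidal category $\mathcal{D}$ and morphism of monoidal quivers $\phi\colon Q\to U\mathcal{D}$ there is a unique linear monoidal functor $\phi'\colon\mathscr{M}Q\to\mathcal{D}$ with $U\phi'\circ\tau=\phi$. For $Q=(M(X),E)$ it is realized as $\mathscr{L}\bar Q/\langle C\rangle$ with $\bar Q$ and $C$ as in the claim; $[f]$ denotes the class of a morphism $f$ of $\mathscr{L}\bar Q$. Its tensor product is concatenation on objects, and on morphisms it is the bilinear operation induced by: $1_a\otimes 1_b=1_{ab}$; $1_a\otimes(v,e,w)=(av,e,w)$ and $(v,e,w)\otimes 1_a=(v,e,wa)$; $1_a\otimes(\alpha_1\circ\dots\circ\alpha_n)=(1_a\otimes\alpha_1)\circ\dots\circ(1_a\otimes\alpha_n)$ and similarly for $-\otimes1_a$, the $\alpha_i$ being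 edges; and $f\otimes g=(f\otimes 1_d)\circ(1_a\otimes g)$ for paths $f\colon a\to b$, $g\colon c\to d$. The map $\tau$ is the identity on vertices and $\tau(e)=[(\mathbb{1},e,\mathbb{1})]$, so that $[(v,e,w)]=1_v\otimes\tau(e)\otimes1_w$. A tensor ideal $\mathcal{I}$ of a linear monoidal category $\mathcal{D}$ is an ideal such that $f\otimes g$ lies in $\mathcal{I}$ whenever $f,g$ are morphisms of $\mathcal{D}$ and at least one of them lies in $\mathcal{I}$; $\langle R\rangle_\otimes$ is the smallest tensor ideal containing $R$. The quotient of $\mathcal{D}$ by a tensor ideal is the quotient linear category with $[f]\otimes[g]=[f\otimes g]$. A presentation of a linear monoidal category $\mathcal{D}$ is a triple $(X,E,R)_\otimes$, where $E$ is the edge set of a quiver $Q=(M(X),E)$ and $R$ is a set of morphisms of $\mathscr{M}Q$, such that $\mathcal{D}$ is isomorphic, as a linear monoidal category, to $\mathscr{M}Q/\langle R\rangle_\otimes$. Convention: if a path $f_i$ occurring in $r$ is trivial, $f_i=1_x$ (the case $n_i=0$), then $(f_i)_{a,b}=1_{axb}$. *)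

theory Defs
  imports "HOL-Algebra.Module" "HOL-Algebra.QuotRing" "Graph_Theory.Arc_Walk"
begin

section \<open>Linear categories\<close>

text \<open>
  Hom-modules are given as a family, so they need not be disjoint. \<open>Comp C a b c g f\<close> is
  the composite of \<open>f : a \<rightarrow> b\<close> and \<open>g : b \<rightarrow> c\<close>. The ring multiplication and
  the ring unit contained in a module record play no role.
\<close>

record ('k, 'o, 'm) lincat =
  Ob :: "'o set"
  Hom :: "'o \<Rightarrow> 'o \<Rightarrow> ('k, 'm) module"
  Comp :: "'o \<Rightarrow> 'o \<Rightarrow> 'o \<Rightarrow> 'm \<Rightarrow> 'm \<Rightarrow> 'm"
  Ident :: "'o \<Rightarrow> 'm"

text \<open>A morphism is recorded together with its source and its target.\<close>

definition mors :: "('k, 'o, 'm, 'z) lincat_scheme \<Rightarrow> ('o \<times> 'o \<times> 'm) set" where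
  "mors C = {(a, b, f). a \<in> Ob C \<and> b \<in> Ob C \<and> f \<in> carrier (Hom C a b)}"

locale linear_category =
  fixes K :: "('k, 'r) ring_scheme" and C :: "('k, 'o, 'm, 'z) lincat_scheme"
  assumes ground_ring: "cring K"
    and hom_module: "\<lbrakk>a \<in> Ob C; b \<in> Ob C\<rbrakk> \<Longrightarrow> Module.module K (Hom C a b)"
    and ident_closed: "a \<in> Ob C \<Longrightarrow> Ident C a \<in> carrier (Hom C a a)"
    and comp_closed: "\<lbrakk>(a, b, f) \<in> mors C; (b, c, g) \<in> mors C\<rbrakk>
      \<Longrightarrow> Comp C a b c g f \<in> carrier (Hom C a c)"
    and comp_ident_right: "(a, b, f) \<in> mors C \<Longrightarrow> Comp C a a b f (Ident C a) = f"
    and comp_ident_left: "(a, b, f) \<in> mors C \<Longrightarrow> Comp C a b b (Ident C b) f = f"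
    and comp_assoc:
      "\<lbrakk>(a, b, f) \<in> mors C; (b, c, g) \<in> mors C; (c, d, h) \<in> mors C\<rbrakk>
      \<Longrightarrow> Comp C a b d (Comp C b c d h g) f = Comp C a c d h (Comp C a b c g f)"
    and comp_add_left:
      "\<lbrakk>(a, b, f) \<in> mors C; (b, c, g) \<in> mors C; (b, c, g') \<in> mors C\<rbrakk>
      \<Longrightarrow> Comp C a b c (g \<oplus>\<^bsub>Hom C b c\<^esub> g') f
        = Comp C a b c g f \<oplus>\<^bsub>Hom C a c\<^esub> Comp C a b c g' f"
    and comp_add_right:
      "\<lbrakk>(a, b, f) \<in> mors C; (a, b, f') \<in> mors C; (b, c, g) \<in> mors C\<rbrakk>
      \<Longrightarrow> Comp C a b c g (f \<oplus>\<^bsub>Hom C a b\<^esub> f')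
        = Comp C a b c g f \<oplus>\<^bsub>Hom C a c\<^esub> Comp C a b c g f'"
    and comp_smult_left:
      "\<lbrakk>k \<in> carrier K; (a, b, f) \<in> mors C; (b, c, g) \<in> mors C\<rbrakk>
      \<Longrightarrow> Comp C a b c (k \<odot>\<^bsub>Hom C b c\<^esub> g) f = k \<odot>\<^bsub>Hom C a c\<^esub> Comp C a b c g f"
    and comp_smult_right:
      "\<lbrakk>k \<in> carrier K; (a, b, f) \<in> mors C; (b, c, g) \<in> mors C\<rbrakk>
      \<Longrightarrow> Comp C a b c g (k \<odot>\<^bsub>Hom C a b\<^esub> f) = k \<odot>\<^bsub>Hom C a c\<^esub> Comp C a b c g f"

definition linear_functor ::
  "('k, 'r) ring_scheme \<Rightarrow> ('k, 'o, 'm, 'z) lincat_scheme \<Rightarrow> ('k, 'p, 'n, 'y) lincat_scheme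
    \<Rightarrow> ('o \<Rightarrow> 'p) \<Rightarrow> ('o \<Rightarrow> 'o \<Rightarrow> 'm \<Rightarrow> 'n) \<Rightarrow> bool" where
  "linear_functor K C D F \<Phi> \<longleftrightarrow>
    F \<in> Ob C \<rightarrow> Ob D \<and>
    (\<forall>a\<in>Ob C. \<forall>b\<in>Ob C. \<Phi> a b \<in> carrier (Hom C a b) \<rightarrow> carrier (Hom D (F a) (F b))) \<and>
    (\<forall>a\<in>Ob C. \<Phi> a a (Ident C a) = Ident D (F a)) \<and>
    (\<forall>a\<in>Ob C. \<forall>b\<in>Ob C. \<forall>c\<in>Ob C. \<forall>f\<in>carrier (Hom C a b). \<forall>g\<in>carrier (Hom C b c).
      \<Phi> a c (Comp C a b c g f) = Comp D (F a) (F b) (F c) (\<Phi> b c g) (\<Phi> a b f)) \<and>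
    (\<forall>a\<in>Ob C. \<forall>b\<in>Ob C. \<forall>f\<in>carrier (Hom C a b). \<forall>f'\<in>carrier (Hom C a b).
      \<Phi> a b (f \<oplus>\<^bsub>Hom C a b\<^esub> f') = \<Phi> a b f \<oplus>\<^bsub>Hom D (F a) (F b)\<^esub> \<Phi> a b f') \<and>
    (\<forall>a\<in>Ob C. \<forall>b\<in>Ob C. \<forall>k\<in>carrier K. \<forall>f\<in>carrier (Hom C a b).
      \<Phi> a b (k \<odot>\<^bsub>Hom C a b\<^esub> f) = k \<odot>\<^bsub>Hom D (F a) (F b)\<^esub> \<Phi> a b f)"

definition bijective_functor ::
  "('k, 'o, 'm, 'z) lincat_scheme \<Rightarrow> ('k, 'p, 'n, 'y) lincat_scheme
    \<Rightarrow> ('o \<Rightarrow> 'p) \<Rightarrow> ('o \<Rightarrow> 'o \<Rightarrow> 'm \<Rightarrow> 'n) \<Rightarrow> bool" where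
  "bijective_functor C D F \<Phi> \<longleftrightarrow>
    bij_betw F (Ob C) (Ob D) \<and>
    (\<forall>a\<in>Ob C. \<forall>b\<in>Ob C.
      bij_betw (\<Phi> a b) (carrier (Hom C a b)) (carrier (Hom D (F a) (F b))))"

definition linearly_isomorphic ::
  "('k, 'r) ring_scheme \<Rightarrow> ('k, 'o, 'm, 'z) lincat_scheme \<Rightarrow> ('k, 'p, 'n, 'y) lincat_scheme
    \<Rightarrow> bool" where
  "linearly_isomorphic K C D \<longleftrightarrow>
    (\<exists>F \<Phi>. linear_functor K C D F \<Phi> \<and> bijective_functor C D F \<Phi>)"


section \<open>Ideals and quotients\<close>

definition cat_ideal ::
  "('k, 'r) ring_scheme \<Rightarrow> ('k, 'o, 'm, 'z) lincat_scheme \<Rightarrow> ('o \<Rightarrow> 'o \<Rightarrow> 'm set) \<Rightarrow> bool" where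
  "cat_ideal K C I \<longleftrightarrow>
    (\<forall>a\<in>Ob C. \<forall>b\<in>Ob C. submodule (I a b) K (Hom C a b)) \<and>
    (\<forall>a\<in>Ob C. \<forall>b\<in>Ob C. \<forall>c\<in>Ob C. \<forall>f\<in>carrier (Hom C a b). \<forall>g\<in>carrier (Hom C b c).
      f \<in> I a b \<or> g \<in> I b c \<longrightarrow> Comp C a b c g f \<in> I a c)"

definition generated_ideal ::
  "('k, 'r) ring_scheme \<Rightarrow> ('k, 'o, 'm, 'z) lincat_scheme \<Rightarrow> ('o \<times> 'o \<times> 'm) set
    \<Rightarrow> 'o \<Rightarrow> 'o \<Rightarrow> 'm set" where
  "generated_ideal K C S a b =
    \<Inter> {I a b | I. cat_ideal K C I \<and> (\<forall>(c, d, f)\<in>S. f \<in> I c d)}"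

definition quotient_module :: "('k, 'm) module \<Rightarrow> 'm set \<Rightarrow> ('k, 'm set) module" where
  "quotient_module M N =
    \<lparr>carrier = a_rcosets\<^bsub>M\<^esub> N, monoid.mult = undefined, one = undefined,
     zero = N, add = (\<lambda>A B. A <+>\<^bsub>M\<^esub> B),
     smult = (\<lambda>k A. \<Union>x\<in>A. N +>\<^bsub>M\<^esub> (k \<odot>\<^bsub>M\<^esub> x))\<rparr>"

text \<open>
  As in \<^const>\<open>rcoset_mult\<close>, an operation on cosets is the union of the cosets
  of the results for all representatives, which is a single coset if the operation respects the
  ideal.
\<close>

definition quotient_category ::
  "('k, 'o, 'm, 'z) lincat_scheme \<Rightarrow> ('o \<Rightarrow> 'o \<Rightarrow> 'm set) \<Rightarrow> ('k, 'o, 'm set) lincat" where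
  "quotient_category C I =
    \<lparr>Ob = Ob C,
     Hom = (\<lambda>a b. quotient_module (Hom C a b) (I a b)),
     Comp = (\<lambda>a b c G F. \<Union>g\<in>G. \<Union>f\<in>F. I a c +>\<^bsub>Hom C a c\<^esub> Comp C a b c g f),
     Ident = (\<lambda>a. I a a +>\<^bsub>Hom C a a\<^esub> Ident C a)\<rparr>"


section \<open>Free linear categories and presentations\<close>

text \<open>
  A quiver is a \<^typ>\<open>('v, 'e) pre_digraph\<close> satisfying \<^locale>\<open>wf_digraph\<close>. A path
  from \<open>a\<close> to \<open>b\<close> is a list \<open>p\<close> of arcs with \<open>awalk a p b\<close>; the empty list is the trivial
  path. Such a list enumerates the edges in the order in which they are traversed, so the
  formal composite \<open>e\<^sub>1 \<circ> \<dots> \<circ> e\<^sub>n\<close> is the list \<open>[e\<^sub>n, \<dots>, e\<^sub>1]\<close>, and \<open>q \<circ> p\<close> is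
  \<open>p @ q\<close>.
\<close>

definition paths :: "('v, 'e) pre_digraph \<Rightarrow> 'v \<Rightarrow> 'v \<Rightarrow> 'e list set" where
  "paths Q a b = {p. pre_digraph.awalk Q a p b}"

definition free_module :: "('k, 'r) ring_scheme \<Rightarrow> 's set \<Rightarrow> ('k, 's \<Rightarrow> 'k) module" where
  "free_module K S =
    \<lparr>carrier = {f. (\<forall>s. f s \<in> carrier K) \<and> (\<forall>s. s \<notin> S \<longrightarrow> f s = \<zero>\<^bsub>K\<^esub>)
        \<and> finite {s. f s \<noteq> \<zero>\<^bsub>K\<^esub>}},
     monoid.mult = undefined, one = undefined,
     zero = (\<lambda>s. \<zero>\<^bsub>K\<^esub>), add = (\<lambda>f g s. f s \<oplus>\<^bsub>K\<^esub> g s), smult = (\<lambda>k f s. k \<otimes>\<^bsub>K\<^esub> f s)\<rparr>"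

definition basis_elt :: "('k, 'r) ring_scheme \<Rightarrow> 's \<Rightarrow> 's \<Rightarrow> 'k" where
  "basis_elt K s = (\<lambda>t. if t = s then \<one>\<^bsub>K\<^esub> else \<zero>\<^bsub>K\<^esub>)"

text \<open>Bilinear extension of an operation \<open>m\<close> on basis elements.\<close>

definition bilinear_extension ::
  "('k, 'r) ring_scheme \<Rightarrow> ('s \<Rightarrow> 't \<Rightarrow> 'u) \<Rightarrow> ('s \<Rightarrow> 'k) \<Rightarrow> ('t \<Rightarrow> 'k) \<Rightarrow> 'u \<Rightarrow> 'k" where
  "bilinear_extension K m f g =
    (\<lambda>u. \<Oplus>\<^bsub>K\<^esub>st\<in>{(s, t). f s \<noteq> \<zero>\<^bsub>K\<^esub> \<and> g t \<noteq> \<zero>\<^bsub>K\<^esub> \<and> m s t = u}.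
      f (fst st) \<otimes>\<^bsub>K\<^esub> g (snd st))"

definition free_lincat ::
  "('k, 'r) ring_scheme \<Rightarrow> ('v, 'e) pre_digraph \<Rightarrow> ('k, 'v, 'e list \<Rightarrow> 'k) lincat" where
  "free_lincat K Q =
    \<lparr>Ob = verts Q,
     Hom = (\<lambda>a b. free_module K (paths Q a b)),
     Comp = (\<lambda>a b c. bilinear_extension K (\<lambda>q p. p @ q)),
     Ident = (\<lambda>a. basis_elt K [])\<rparr>"

definition linear_presentation ::
  "('k, 'r) ring_scheme \<Rightarrow> ('k, 'o, 'm, 'z) lincat_scheme \<Rightarrow> ('v, 'e) pre_digraph
    \<Rightarrow> ('v \<times> 'v \<times> ('e list \<Rightarrow> 'k)) set \<Rightarrow> bool" where
  "linear_presentation K C Q R \<longleftrightarrow>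
    wf_digraph Q \<and> R \<subseteq> mors (free_lincat K Q) \<and>
    linearly_isomorphic K C
      (quotient_category (free_lincat K Q) (generated_ideal K (free_lincat K Q) R))"


section \<open>Strict linear monoidal categories\<close>

text \<open>\<open>Tens D a b c d f g\<close> is the tensor product of \<open>f : a \<rightarrow> b\<close> and \<open>g : c \<rightarrow> d\<close>.\<close>

record ('k, 'o, 'm) lmcat = "('k, 'o, 'm) lincat" +
  TensOb :: "'o \<Rightarrow> 'o \<Rightarrow> 'o"
  UnitOb :: "'o"
  Tens :: "'o \<Rightarrow> 'o \<Rightarrow> 'o \<Rightarrow> 'o \<Rightarrow> 'm \<Rightarrow> 'm \<Rightarrow> 'm"

locale linear_monoidal_category = linear_category K D
  for K :: "('k, 'r) ring_scheme" and D :: "('k, 'o, 'm, 'z) lmcat_scheme" +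
  assumes object_monoid: "monoid \<lparr>carrier = Ob D, monoid.mult = TensOb D, one = UnitOb D\<rparr>"
    and tens_closed: "\<lbrakk>(a, b, f) \<in> mors D; (c, d, g) \<in> mors D\<rbrakk>
      \<Longrightarrow> Tens D a b c d f g \<in> carrier (Hom D (TensOb D a c) (TensOb D b d))"
    and tens_ident: "\<lbrakk>a \<in> Ob D; b \<in> Ob D\<rbrakk>
      \<Longrightarrow> Tens D a a b b (Ident D a) (Ident D b) = Ident D (TensOb D a b)"
    and tens_comp:
      "\<lbrakk>(a, b, f) \<in> mors D; (b, c, f') \<in> mors D;
        (a', b', g) \<in> mors D; (b', c', g') \<in> mors D\<rbrakk>
      \<Longrightarrow> Tens D a c a' c' (Comp D a b c f' f) (Comp D a' b' c' g' g)
        = Comp D (TensOb D a a') (TensOb D b b') (TensOb D c c')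
            (Tens D b c b' c' f' g') (Tens D a b a' b' f g)"
    and tens_add_left:
      "\<lbrakk>(a, b, f) \<in> mors D; (a, b, f') \<in> mors D; (c, d, g) \<in> mors D\<rbrakk>
      \<Longrightarrow> Tens D a b c d (f \<oplus>\<^bsub>Hom D a b\<^esub> f') g
        = Tens D a b c d f g \<oplus>\<^bsub>Hom D (TensOb D a c) (TensOb D b d)\<^esub> Tens D a b c d f' g"
    and tens_add_right:
      "\<lbrakk>(a, b, f) \<in> mors D; (c, d, g) \<in> mors D; (c, d, g') \<in> mors D\<rbrakk>
      \<Longrightarrow> Tens D a b c d f (g \<oplus>\<^bsub>Hom D c d\<^esub> g')
        = Tens D a b c d f g \<oplus>\<^bsub>Hom D (TensOb D a c) (TensOb D b d)\<^esub> Tens D a b c d f g'"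
    and tens_smult_left:
      "\<lbrakk>k \<in> carrier K; (a, b, f) \<in> mors D; (c, d, g) \<in> mors D\<rbrakk>
      \<Longrightarrow> Tens D a b c d (k \<odot>\<^bsub>Hom D a b\<^esub> f) g
        = k \<odot>\<^bsub>Hom D (TensOb D a c) (TensOb D b d)\<^esub> Tens D a b c d f g"
    and tens_smult_right:
      "\<lbrakk>k \<in> carrier K; (a, b, f) \<in> mors D; (c, d, g) \<in> mors D\<rbrakk>
      \<Longrightarrow> Tens D a b c d f (k \<odot>\<^bsub>Hom D c d\<^esub> g)
        = k \<odot>\<^bsub>Hom D (TensOb D a c) (TensOb D b d)\<^esub> Tens D a b c d f g"
    and tens_assoc:
      "\<lbrakk>(a, a', f) \<in> mors D; (b, b', g) \<in> mors D; (c, c', h) \<in> mors D\<rbrakk>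
      \<Longrightarrow> Tens D (TensOb D a b) (TensOb D a' b') c c' (Tens D a a' b b' f g) h
        = Tens D a a' (TensOb D b c) (TensOb D b' c') f (Tens D b b' c c' g h)"
    and tens_unit_left: "(a, b, f) \<in> mors D
      \<Longrightarrow> Tens D (UnitOb D) (UnitOb D) a b (Ident D (UnitOb D)) f = f"
    and tens_unit_right: "(a, b, f) \<in> mors D
      \<Longrightarrow> Tens D a b (UnitOb D) (UnitOb D) f (Ident D (UnitOb D)) = f"

definition linear_monoidal_functor ::
  "('k, 'r) ring_scheme \<Rightarrow> ('k, 'o, 'm, 'z) lmcat_scheme \<Rightarrow> ('k, 'p, 'n, 'y) lmcat_scheme
    \<Rightarrow> ('o \<Rightarrow> 'p) \<Rightarrow> ('o \<Rightarrow> 'o \<Rightarrow> 'm \<Rightarrow> 'n) \<Rightarrow> bool" where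
  "linear_monoidal_functor K C D F \<Phi> \<longleftrightarrow>
    linear_functor K C D F \<Phi> \<and>
    F (UnitOb C) = UnitOb D \<and>
    (\<forall>a\<in>Ob C. \<forall>b\<in>Ob C. F (TensOb C a b) = TensOb D (F a) (F b)) \<and>
    (\<forall>a\<in>Ob C. \<forall>b\<in>Ob C. \<forall>c\<in>Ob C. \<forall>d\<in>Ob C.
      \<forall>f\<in>carrier (Hom C a b). \<forall>g\<in>carrier (Hom C c d).
        \<Phi> (TensOb C a c) (TensOb C b d) (Tens C a b c d f g)
          = Tens D (F a) (F b) (F c) (F d) (\<Phi> a b f) (\<Phi> c d g))"

definition monoidally_isomorphic ::
  "('k, 'r) ring_scheme \<Rightarrow> ('k, 'o, 'm, 'z) lmcat_scheme \<Rightarrow> ('k, 'p, 'n, 'y) lmcat_scheme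
    \<Rightarrow> bool" where
  "monoidally_isomorphic K C D \<longleftrightarrow>
    (\<exists>F \<Phi>. linear_monoidal_functor K C D F \<Phi> \<and> bijective_functor C D F \<Phi>)"

definition tensor_ideal ::
  "('k, 'r) ring_scheme \<Rightarrow> ('k, 'o, 'm, 'z) lmcat_scheme \<Rightarrow> ('o \<Rightarrow> 'o \<Rightarrow> 'm set) \<Rightarrow> bool" where
  "tensor_ideal K D I \<longleftrightarrow>
    cat_ideal K D I \<and>
    (\<forall>a\<in>Ob D. \<forall>b\<in>Ob D. \<forall>c\<in>Ob D. \<forall>d\<in>Ob D.
      \<forall>f\<in>carrier (Hom D a b). \<forall>g\<in>carrier (Hom D c d).
        f \<in> I a b \<or> g \<in> I c d
          \<longrightarrow> Tens D a b c d f g \<in> I (TensOb D a c) (TensOb D b d))"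

definition generated_tensor_ideal ::
  "('k, 'r) ring_scheme \<Rightarrow> ('k, 'o, 'm, 'z) lmcat_scheme \<Rightarrow> ('o \<times> 'o \<times> 'm) set
    \<Rightarrow> 'o \<Rightarrow> 'o \<Rightarrow> 'm set" where
  "generated_tensor_ideal K D S a b =
    \<Inter> {I a b | I. tensor_ideal K D I \<and> (\<forall>(c, d, f)\<in>S. f \<in> I c d)}"

definition quotient_monoidal ::
  "('k, 'o, 'm, 'z) lmcat_scheme \<Rightarrow> ('o \<Rightarrow> 'o \<Rightarrow> 'm set) \<Rightarrow> ('k, 'o, 'm set) lmcat" where
  "quotient_monoidal D I =
    \<lparr>Ob = Ob (quotient_category D I),
     Hom = Hom (quotient_category D I),
     Comp = Comp (quotient_category D I),
     Ident = Ident (quotient_category D I),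
     TensOb = TensOb D,
     UnitOb = UnitOb D,
     Tens = (\<lambda>a b c d F G. \<Union>f\<in>F. \<Union>g\<in>G.
       I (TensOb D a c) (TensOb D b d)
         +>\<^bsub>Hom D (TensOb D a c) (TensOb D b d)\<^esub> Tens D a b c d f g)\<rparr>"


section \<open>Free linear monoidal categories and presentations\<close>

text \<open>
  Throughout, \<open>Q\<close> is a quiver whose vertex set is the free monoid \<^term>\<open>lists X\<close>, with
  concatenation as product and \<^term>\<open>[]\<close> as unit.
\<close>

definition bar_quiver ::
  "('x list, 'e) pre_digraph \<Rightarrow> ('x list, 'x list \<times> 'e \<times> 'x list) pre_digraph" where
  "bar_quiver Q =
    \<lparr>verts = verts Q, arcs = verts Q \<times> arcs Q \<times> verts Q,
     tail = (\<lambda>(v, e, w). v @ tail Q e @ w), head = (\<lambda>(v, e, w). v @ head Q e @ w)\<rparr>"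

text \<open>\<open>whisker a b p\<close> is \<open>p\<^bsub>a,b\<^esub> = 1\<^sub>a \<otimes> p \<otimes> 1\<^sub>b\<close>, for a path \<open>p\<close> of the bar quiver.\<close>

definition whisker ::
  "'x list \<Rightarrow> 'x list \<Rightarrow> ('x list \<times> 'e \<times> 'x list) list \<Rightarrow> ('x list \<times> 'e \<times> 'x list) list" where
  "whisker a b p = map (\<lambda>(v, e, w). (a @ v, e, w @ b)) p"

text \<open>
  The tensor product \<open>p \<otimes> q = (p \<otimes> 1\<^sub>d) \<circ> (1\<^sub>a \<otimes> q)\<close> of paths \<open>p : a \<rightarrow> b\<close> and
  \<open>q : c \<rightarrow> d\<close>; the factor \<open>1\<^sub>a \<otimes> q\<close> is traversed first.
\<close>

definition path_tensor ::
  "'x list \<Rightarrow> 'x list \<Rightarrow> ('x list \<times> 'e \<times> 'x list) list \<Rightarrow> ('x list \<times> 'e \<times> 'x list) list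
    \<Rightarrow> ('x list \<times> 'e \<times> 'x list) list" where
  "path_tensor a d p q = whisker a [] q @ whisker [] d p"

text \<open>
  The free linear category on the bar quiver, with the tensor operation that becomes a bifunctor
  after passing to the quotient by the interchange relations. It is not itself a linear monoidal
  category.
\<close>

definition free_pre_monoidal ::
  "('k, 'r) ring_scheme \<Rightarrow> ('x list, 'e) pre_digraph
    \<Rightarrow> ('k, 'x list, ('x list \<times> 'e \<times> 'x list) list \<Rightarrow> 'k) lmcat" where
  "free_pre_monoidal K Q =
    \<lparr>Ob = Ob (free_lincat K (bar_quiver Q)),
     Hom = Hom (free_lincat K (bar_quiver Q)),
     Comp = Comp (free_lincat K (bar_quiver Q)),
     Ident = Ident (free_lincat K (bar_quiver Q)),
     TensOb = (@),
     UnitOb = [],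
     Tens = (\<lambda>a b c d. bilinear_extension K (path_tensor a d))\<rparr>"

text \<open>
  The set \<open>C\<close> of differences
  \<open>(v,e,wv'y'w') \<circ> (vxwv',e',w') - (vywv',e',w') \<circ> (v,e,wv'x'w')\<close> for \<open>e : x \<rightarrow> y\<close> and
  \<open>e' : x' \<rightarrow> y'\<close>.
\<close>

definition interchange ::
  "('k, 'r) ring_scheme \<Rightarrow> ('x list, 'e) pre_digraph
    \<Rightarrow> ('x list \<times> 'x list \<times> (('x list \<times> 'e \<times> 'x list) list \<Rightarrow> 'k)) set" where
  "interchange K Q =
    {(a, b,
      basis_elt K [(v @ x @ w @ v', e', w'), (v, e, w @ v' @ y' @ w')]
        \<ominus>\<^bsub>Hom (free_lincat K (bar_quiver Q)) a b\<^esub>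
      basis_elt K [(v, e, w @ v' @ x' @ w'), (v @ y @ w @ v', e', w')])
     | a b v w v' w' e e' x y x' y'.
       v \<in> verts Q \<and> w \<in> verts Q \<and> v' \<in> verts Q \<and> w' \<in> verts Q \<and>
       e \<in> arcs Q \<and> e' \<in> arcs Q \<and>
       x = tail Q e \<and> y = head Q e \<and> x' = tail Q e' \<and> y' = head Q e' \<and>
       a = v @ x @ w @ v' @ x' @ w' \<and> b = v @ y @ w @ v' @ y' @ w'}"

abbreviation interchange_ideal ::
  "('k, 'r) ring_scheme \<Rightarrow> ('x list, 'e) pre_digraph
    \<Rightarrow> 'x list \<Rightarrow> 'x list \<Rightarrow> (('x list \<times> 'e \<times> 'x list) list \<Rightarrow> 'k) set" where
  "interchange_ideal K Q \<equiv> generated_ideal K (free_lincat K (bar_quiver Q)) (interchange K Q)"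

text \<open>The standard realization of the free linear monoidal category over \<open>Q\<close>.\<close>

definition free_monoidal ::
  "('k, 'r) ring_scheme \<Rightarrow> ('x list, 'e) pre_digraph
    \<Rightarrow> ('k, 'x list, (('x list \<times> 'e \<times> 'x list) list \<Rightarrow> 'k) set) lmcat" where
  "free_monoidal K Q = quotient_monoidal (free_pre_monoidal K Q) (interchange_ideal K Q)"

definition monoidal_presentation ::
  "('k, 'r) ring_scheme \<Rightarrow> ('k, 'o, 'm, 'z) lmcat_scheme \<Rightarrow> 'x set \<Rightarrow> ('x list, 'e) pre_digraph
    \<Rightarrow> ('x list \<times> 'x list \<times> (('x list \<times> 'e \<times> 'x list) list \<Rightarrow> 'k) set) set \<Rightarrow> bool" where
  "monoidal_presentation K D X Q R \<longleftrightarrow>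
    wf_digraph Q \<and> verts Q = lists X \<and> R \<subseteq> mors (free_monoidal K Q) \<and>
    monoidally_isomorphic K D
      (quotient_monoidal (free_monoidal K Q) (generated_tensor_ideal K (free_monoidal K Q) R))"


section \<open>The relations of the linear presentation\<close>

text \<open>
  A formal linear combination \<open>k\<^sub>1 f\<^sub>1 + \<dots> + k\<^sub>n f\<^sub>n\<close> is the list of the pairs
  \<open>(k\<^sub>i, f\<^sub>i)\<close>; repeated paths and zero coefficients are allowed.
\<close>

definition is_combination ::
  "('k, 'r) ring_scheme \<Rightarrow> ('v, 'e) pre_digraph \<Rightarrow> 'v \<Rightarrow> 'v \<Rightarrow> ('k \<times> 'e list) list \<Rightarrow> bool" where
  "is_combination K Q a b t \<longleftrightarrow> (\<forall>(k, p)\<in>set t. k \<in> carrier K \<and> p \<in> paths Q a b)"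

definition combination ::
  "('k, 'r) ring_scheme \<Rightarrow> ('v, 'e) pre_digraph \<Rightarrow> 'v \<Rightarrow> 'v \<Rightarrow> ('k \<times> 'e list) list
    \<Rightarrow> 'e list \<Rightarrow> 'k" where
  "combination K Q a b t =
    (\<Oplus>\<^bsub>Hom (free_lincat K Q) a b\<^esub>i\<in>{..<length t}.
      fst (t ! i) \<odot>\<^bsub>Hom (free_lincat K Q) a b\<^esub> basis_elt K (snd (t ! i)))"

text \<open>
  \<open>expresses K Q a b t \<rho>\<close>: the morphism \<open>\<rho> : a \<rightarrow> b\<close> of the free linear monoidal category
  is written as \<open>\<rho> = [r] = \<Sum>\<^sub>i k\<^sub>i [f\<^sub>i]\<close> with \<open>r = \<Sum>\<^sub>i k\<^sub>i f\<^sub>i\<close> given by \<open>t\<close>.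
\<close>

definition expresses ::
  "('k, 'r) ring_scheme \<Rightarrow> ('x list, 'e) pre_digraph \<Rightarrow> 'x list \<Rightarrow> 'x list
    \<Rightarrow> ('k \<times> ('x list \<times> 'e \<times> 'x list) list) list
    \<Rightarrow> (('x list \<times> 'e \<times> 'x list) list \<Rightarrow> 'k) set \<Rightarrow> bool" where
  "expresses K Q a b t \<rho> \<longleftrightarrow>
    is_combination K (bar_quiver Q) a b t \<and>
    \<rho> = interchange_ideal K Q a b
          +>\<^bsub>Hom (free_lincat K (bar_quiver Q)) a b\<^esub> combination K (bar_quiver Q) a b t"

text \<open>
  The relations \<open>r\<^bsub>a,b\<^esub>\<close>, where \<open>rep\<close> chooses for every relation \<open>\<rho> : c \<rightarrow> d\<close> in \<open>R\<close> the
  linear combination of paths of the bar quiver by which it is written.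
\<close>

definition whiskered_relations ::
  "('k, 'r) ring_scheme \<Rightarrow> ('x list, 'e) pre_digraph \<Rightarrow> ('x list \<times> 'x list \<times> 'm) set
    \<Rightarrow> ('x list \<times> 'x list \<times> 'm \<Rightarrow> ('k \<times> ('x list \<times> 'e \<times> 'x list) list) list)
    \<Rightarrow> ('x list \<times> 'x list \<times> (('x list \<times> 'e \<times> 'x list) list \<Rightarrow> 'k)) set" where
  "whiskered_relations K Q R rep =
    {(a @ c @ b, a @ d @ b,
      combination K (bar_quiver Q) (a @ c @ b) (a @ d @ b)
        (map (\<lambda>(k, f). (k, whisker a b f)) (rep (c, d, \<rho>))))
     | a b c d \<rho>. a \<in> verts Q \<and> b \<in> verts Q \<and> (c, d, \<rho>) \<in> R}"

end

theory Submission
  imports Defs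
begin

text \<open>
  Let \<open>L\<close> be the free linear category on the bar quiver, \<open>I\<close> the ideal generated by the interchange
  relations \<open>C\<close>, and \<open>J\<close> the tensor ideal of \<open>L/I\<close> generated by \<open>R\<close>. The category \<open>M\<close> is
  isomorphic to \<open>(L/I)/J\<close>, and a third isomorphism theorem (\<open>iterated_quotient\<close>) identifies this
  with the quotient of \<open>L\<close> by the preimage of \<open>J\<close>. It remains to see that the preimage
  of \<open>J\<close> is the ordinary ideal \<open>P\<close> generated by \<open>C \<union> R'\<close>, that is, that the relations in \<open>R'\<close> make
  up for the closure under tensor products.

  The point is that \<open>f \<otimes> g = (f \<otimes> 1) \<circ> (1 \<otimes> g)\<close> (\<open>tensor_eq_comp\<close>), so that an ordinary ideal
  is closed under tensoring with arbitrary morphisms as soon as it is stable under whiskering,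
  \<open>f \<mapsto> 1\<^sub>a \<otimes> f \<otimes> 1\<^sub>b\<close>. Whiskering is linear and respects composition already in \<open>L\<close>, where
  \<open>\<otimes>\<close> is in general not yet a bifunctor. Hence the ideal generated by a whiskering-stable set is itself
  stable (\<open>W_ideal\<close>). The set \<open>C\<close> is stable because whiskering an interchange relation only
  enlarges its outer words \<open>v\<close> and \<open>w'\<close>, and \<open>R'\<close> is stable because whiskering
  \<open>r\<^bsub>a,b\<^esub>\<close> by \<open>x\<close> and \<open>y\<close> gives \<open>r\<^bsub>xa,by\<^esub>\<close>.

  Consequently the image of \<open>P\<close> in \<open>L/I\<close> is a tensor ideal. It contains every \<open>\<rho>\<close> in \<open>R\<close>, as
  \<open>\<rho>\<close> is the class of \<open>r\<close> whiskered by the empty words, so it contains \<open>J\<close>; since \<open>I\<close> lies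
  in \<open>P\<close>, the preimage of \<open>J\<close> lies in \<open>P\<close> (\<open>J_imp_P\<close>). Conversely, the class of
  \<open>r\<^bsub>a,b\<^esub>\<close> is \<open>1\<^sub>a \<otimes> \<rho> \<otimes> 1\<^sub>b\<close>, which lies in \<open>J\<close>, so the preimage of \<open>J\<close>
  is an ideal containing \<open>C \<union> R'\<close> and hence \<open>P\<close> (\<open>P_imp_J\<close>).

  All identities between operations of \<open>L\<close> are multilinear, so they are checked on paths only;
  this is what \<open>linear_map_eqI\<close> is for.
\<close>


section \<open>Modules and their quotients\<close>

definition linear_map ::
  "('k, 'r) ring_scheme \<Rightarrow> ('k, 'm) module \<Rightarrow> ('k, 'n) module \<Rightarrow> ('m \<Rightarrow> 'n) \<Rightarrow> bool" where
  "linear_map K M N h \<longleftrightarrow>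
    h \<in> carrier M \<rightarrow> carrier N \<and>
    (\<forall>x\<in>carrier M. \<forall>y\<in>carrier M. h (x \<oplus>\<^bsub>M\<^esub> y) = h x \<oplus>\<^bsub>N\<^esub> h y) \<and>
    (\<forall>k\<in>carrier K. \<forall>x\<in>carrier M. h (k \<odot>\<^bsub>M\<^esub> x) = k \<odot>\<^bsub>N\<^esub> h x)"

lemma linear_mapI:
  assumes "\<And>x. x \<in> carrier M \<Longrightarrow> h x \<in> carrier N"
    and "\<And>x y. \<lbrakk>x \<in> carrier M; y \<in> carrier M\<rbrakk> \<Longrightarrow> h (x \<oplus>\<^bsub>M\<^esub> y) = h x \<oplus>\<^bsub>N\<^esub> h y"
    and "\<And>k x. \<lbrakk>k \<in> carrier K; x \<in> carrier M\<rbrakk> \<Longrightarrow> h (k \<odot>\<^bsub>M\<^esub> x) = k \<odot>\<^bsub>N\<^esub> h x"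
  shows "linear_map K M N h"
  using assms by (auto simp: linear_map_def)

lemma linear_mapD:
  assumes "linear_map K M N h"
  shows "x \<in> carrier M \<Longrightarrow> h x \<in> carrier N"
    and "\<lbrakk>x \<in> carrier M; y \<in> carrier M\<rbrakk> \<Longrightarrow> h (x \<oplus>\<^bsub>M\<^esub> y) = h x \<oplus>\<^bsub>N\<^esub> h y"
    and "\<lbrakk>k \<in> carrier K; x \<in> carrier M\<rbrakk> \<Longrightarrow> h (k \<odot>\<^bsub>M\<^esub> x) = k \<odot>\<^bsub>N\<^esub> h x"
  using assms by (auto simp: linear_map_def)

lemma linear_map_comp:
  assumes "linear_map K M N h" and "linear_map K N P g"
  shows "linear_map K M P (\<lambda>x. g (h x))"
  using assms by (auto simp: linear_map_def Pi_iff)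

lemma linear_map_id: "linear_map K M M (\<lambda>x. x)"
  by (simp add: linear_map_def)

lemma module_add_closed:
  "\<lbrakk>Module.module K M; x \<in> carrier M; y \<in> carrier M\<rbrakk> \<Longrightarrow> x \<oplus>\<^bsub>M\<^esub> y \<in> carrier M"
  by (meson Module.module.axioms(2) abelian_group.axioms(1) abelian_monoid.a_closed)

lemma linear_map_zero:
  assumes "Module.module K M" and "Module.module K N" and "linear_map K M N h"
  shows "h \<zero>\<^bsub>M\<^esub> = \<zero>\<^bsub>N\<^esub>"
proof -
  interpret M: Module.module K M by fact
  interpret N: Module.module K N by fact
  show ?thesis
    using linear_mapD(3)[OF assms(3) M.R.zero_closed M.zero_closed]
      linear_mapD(1)[OF assms(3) M.zero_closed]
    by simp
qed

lemma linear_map_neg: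
  assumes "Module.module K M" and "Module.module K N" and "linear_map K M N h" and "x \<in> carrier M"
  shows "h (\<ominus>\<^bsub>M\<^esub> x) = \<ominus>\<^bsub>N\<^esub> h x"
proof -
  interpret M: Module.module K M by fact
  interpret N: Module.module K N by fact
  have "h x \<oplus>\<^bsub>N\<^esub> h (\<ominus>\<^bsub>M\<^esub> x) = h (x \<oplus>\<^bsub>M\<^esub> \<ominus>\<^bsub>M\<^esub> x)"
    using linear_mapD(2)[OF assms(3)] assms(4) by simp
  also have "\<dots> = \<zero>\<^bsub>N\<^esub>"
    using linear_map_zero[OF assms(1-3)] assms(4) by (simp add: M.r_neg)
  finally show ?thesis
    using linear_mapD(1)[OF assms(3)] assms(4)
    by (intro N.minus_equality[symmetric]) (simp_all add: N.a_comm)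
qed

lemma linear_map_minus:
  assumes "Module.module K M" and "Module.module K N" and "linear_map K M N h"
    and "x \<in> carrier M" and "y \<in> carrier M"
  shows "h (x \<ominus>\<^bsub>M\<^esub> y) = h x \<ominus>\<^bsub>N\<^esub> h y"
proof -
  interpret M: Module.module K M by fact
  interpret N: Module.module K N by fact
  show ?thesis
    using assms by (simp add: M.minus_eq N.minus_eq linear_mapD(2)[OF assms(3)] linear_map_neg)
qed

lemma linear_map_finsum:
  assumes "Module.module K M" and "Module.module K N" and "linear_map K M N h"
    and "finite A" and "\<And>i. i \<in> A \<Longrightarrow> f i \<in> carrier M"
  shows "h (finsum M f A) = finsum N (\<lambda>i. h (f i)) A"
proof -
  interpret M: Module.module K M by fact
  interpret N: Module.module K N by fact
  from assms(4,5) show ?thesis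
  proof (induction A rule: finite_induct)
    case empty
    then show ?case using linear_map_zero[OF assms(1-3)] by simp
  next
    case (insert i A)
    then have "f \<in> A \<rightarrow> carrier M" "(\<lambda>i. h (f i)) \<in> A \<rightarrow> carrier N"
      using linear_mapD(1)[OF assms(3)] by auto
    with insert show ?case
      using linear_mapD[OF assms(3)] by (simp add: M.finsum_insert N.finsum_insert)
  qed
qed

lemma module_zero_in_submodule: "submodule N K M \<Longrightarrow> \<zero>\<^bsub>M\<^esub> \<in> N"
  using subgroup.one_closed[OF submodule.axioms(1)] by fastforce

lemma submodule_preimage:
  assumes "Module.module K M" and "Module.module K N" and "linear_map K M N h" and "submodule S K N"
  shows "submodule {x \<in> carrier M. h x \<in> S} K M"
proof -
  interpret M: Module.module K M by fact
  interpret N: Module.module K N by fact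
  have z: "\<zero>\<^bsub>N\<^esub> \<in> S" by (rule module_zero_in_submodule[OF assms(4)])
  show ?thesis
    using linear_mapD[OF assms(3)] N.submoduleE[OF assms(4)] linear_map_zero[OF assms(1-3)]
      linear_map_neg[OF assms(1-3)] z
    by (intro M.submoduleI) auto
qed

lemma submodule_image:
  assumes "Module.module K M" and "Module.module K N" and "linear_map K M N h" and "submodule S K M"
  shows "submodule (h ` S) K N"
proof -
  interpret M: Module.module K M by fact
  interpret N: Module.module K N by fact
  note S = M.submoduleE[OF assms(4)]
  have z: "\<zero>\<^bsub>M\<^esub> \<in> S" by (rule module_zero_in_submodule[OF assms(4)])
  show ?thesis
  proof (rule N.submoduleI)
    show "h ` S \<subseteq> carrier N" using S(1) linear_mapD(1)[OF assms(3)] by auto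
    show "\<zero>\<^bsub>N\<^esub> \<in> h ` S" using z linear_map_zero[OF assms(1-3)] by (metis imageI)
    show "\<ominus>\<^bsub>N\<^esub> y \<in> h ` S" if "y \<in> h ` S" for y
      using that S(1,3) by (auto simp flip: linear_map_neg[OF assms(1-3)])
    show "y \<oplus>\<^bsub>N\<^esub> z \<in> h ` S" if "y \<in> h ` S" "z \<in> h ` S" for y z
      using that S(1,5) by (auto simp: subset_iff simp flip: linear_mapD(2)[OF assms(3)])
    show "k \<odot>\<^bsub>N\<^esub> y \<in> h ` S" if "k \<in> carrier K" "y \<in> h ` S" for k y
      using that S(1,4) by (auto simp: subset_iff simp flip: linear_mapD(3)[OF assms(3)])
  qed
qed

lemma submodule_Inter:
  assumes "Module.module K M" and "\<S> \<noteq> {}" and "\<And>S. S \<in> \<S> \<Longrightarrow> submodule S K M"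
  shows "submodule (\<Inter>\<S>) K M"
proof -
  interpret M: Module.module K M by fact
  note S = M.submoduleE[OF assms(3)]
  have z: "\<zero>\<^bsub>M\<^esub> \<in> S" if "S \<in> \<S>" for S
    by (rule module_zero_in_submodule[OF assms(3)[OF that]])
  show ?thesis
  proof (rule M.submoduleI)
    show "\<Inter>\<S> \<subseteq> carrier M" using S(1) assms(2) by blast
  qed (auto intro: S z)
qed

lemma UN_eq_const: "\<lbrakk>x \<in> A; \<And>y. y \<in> A \<Longrightarrow> f y = B\<rbrakk> \<Longrightarrow> (\<Union>y\<in>A. f y) = B"
  by auto

locale module_submodule = Module.module K M
  for K :: "('k, 'r) ring_scheme" (structure) and M :: "('k, 'm) module" (structure) +
  fixes N :: "'m set"
  assumes submodule: "submodule N K M"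
begin

sublocale N: abelian_subgroup N M
  by (rule abelian_subgroupI3)
    (use submodule M.abelian_group_axioms in
      \<open>auto simp: additive_subgroup_def submodule_def\<close>)

lemma N_smult: "\<lbrakk>k \<in> carrier K; x \<in> N\<rbrakk> \<Longrightarrow> k \<odot>\<^bsub>M\<^esub> x \<in> N"
  using submoduleE(4)[OF submodule] .

text \<open>
  The representative-independence arguments below all reduce to this: changing a representative
  means adding an element of \<open>N\<close>.
\<close>

lemma coset_absorb: "\<lbrakk>n \<in> N; x \<in> carrier M\<rbrakk> \<Longrightarrow> N +>\<^bsub>M\<^esub> (n \<oplus>\<^bsub>M\<^esub> x) = N +>\<^bsub>M\<^esub> x"
  using N.a_rcos_const[of n] M.a_coset_add_assoc[OF N.a_subset, of n x] N.a_Hcarr[of n] by simp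

lemma coset_eq_iff:
  assumes "x \<in> carrier M" and "y \<in> carrier M"
  shows "N +>\<^bsub>M\<^esub> x = N +>\<^bsub>M\<^esub> y \<longleftrightarrow> x \<ominus>\<^bsub>M\<^esub> y \<in> N"
proof -
  have "N +>\<^bsub>M\<^esub> x = N +>\<^bsub>M\<^esub> y \<longleftrightarrow> x \<in> N +>\<^bsub>M\<^esub> y"
    using N.a_repr_independence'[OF _ assms(2)] N.a_rcos_self[OF assms(1)] by blast
  also have "\<dots> \<longleftrightarrow> x \<ominus>\<^bsub>M\<^esub> y \<in> N"
    using N.a_rcos_module[OF assms(2,1)] by (simp add: a_minus_def)
  finally show ?thesis .
qed

lemma minus_mem_imp_mem:
  assumes "x \<ominus>\<^bsub>M\<^esub> y \<in> N" and "y \<in> N" and "x \<in> carrier M"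
  shows "x \<in> N"
proof -
  have "(x \<ominus>\<^bsub>M\<^esub> y) \<oplus>\<^bsub>M\<^esub> y = x"
    using assms N.a_Hcarr[OF assms(2)] by (simp add: M.minus_eq M.a_assoc M.l_neg)
  then show ?thesis using N.a_closed[OF assms(1,2)] by simp
qed

lemma coset_cases:
  assumes "x' \<in> N +>\<^bsub>M\<^esub> x"
  obtains n where "n \<in> N" and "x' = n \<oplus>\<^bsub>M\<^esub> x"
  using assms by (auto simp: a_r_coset_def')

lemma mem_coset_iff:
  assumes "x \<in> carrier M"
  shows "y \<in> N +>\<^bsub>M\<^esub> x \<longleftrightarrow> y \<in> carrier M \<and> N +>\<^bsub>M\<^esub> y = N +>\<^bsub>M\<^esub> x"
  using N.a_repr_independence'[OF _ assms] N.a_rcos_self[of y] N.a_elemrcos_carrier[OF assms]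
  by blast

lemma carrier_quotient: "carrier (quotient_module M N) = (\<lambda>x. N +>\<^bsub>M\<^esub> x) ` carrier M"
  by (auto simp: quotient_module_def A_RCOSETS_def')

lemma zero_quotient: "\<zero>\<^bsub>quotient_module M N\<^esub> = N"
  by (simp add: quotient_module_def)

lemma add_quotient:
  "\<lbrakk>x \<in> carrier M; y \<in> carrier M\<rbrakk> \<Longrightarrow>
    (N +>\<^bsub>M\<^esub> x) \<oplus>\<^bsub>quotient_module M N\<^esub> (N +>\<^bsub>M\<^esub> y) = N +>\<^bsub>M\<^esub> (x \<oplus>\<^bsub>M\<^esub> y)"
  by (simp add: quotient_module_def N.a_rcos_sum)

lemma smult_quotient:
  assumes "k \<in> carrier K" and "x \<in> carrier M"
  shows "k \<odot>\<^bsub>quotient_module M N\<^esub> (N +>\<^bsub>M\<^esub> x) = N +>\<^bsub>M\<^esub> (k \<odot>\<^bsub>M\<^esub> x)"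
proof -
  have "N +>\<^bsub>M\<^esub> (k \<odot>\<^bsub>M\<^esub> x') = N +>\<^bsub>M\<^esub> (k \<odot>\<^bsub>M\<^esub> x)" if x': "x' \<in> N +>\<^bsub>M\<^esub> x" for x'
  proof -
    obtain n where "n \<in> N" "x' = n \<oplus>\<^bsub>M\<^esub> x" using coset_cases[OF x'] .
    then show ?thesis
      using assms by (simp add: smult_r_distr coset_absorb N_smult N.a_Hcarr)
  qed
  then have "(\<Union>x'\<in>N +>\<^bsub>M\<^esub> x. N +>\<^bsub>M\<^esub> (k \<odot>\<^bsub>M\<^esub> x')) = N +>\<^bsub>M\<^esub> (k \<odot>\<^bsub>M\<^esub> x)"
    using N.a_rcos_self[OF assms(2)] by (intro UN_eq_const)
  then show ?thesis
    by (simp add: quotient_module_def)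
qed

lemma coset_zero: "N +>\<^bsub>M\<^esub> \<zero>\<^bsub>M\<^esub> = N"
  using N.a_rcos_const by simp

lemma coset_absorb_zero: "n \<in> N \<Longrightarrow> N +>\<^bsub>M\<^esub> n = \<zero>\<^bsub>quotient_module M N\<^esub>"
  using N.a_rcos_const by (simp add: zero_quotient)

lemma coset_linear_map: "linear_map K M (quotient_module M N) (\<lambda>x. N +>\<^bsub>M\<^esub> x)"
  by (intro linear_mapI) (auto simp: carrier_quotient add_quotient smult_quotient)

lemma module_quotient: "Module.module K (quotient_module M N)"
proof (rule Module.moduleI)
  let ?Q = "quotient_module M N"
  have zero: "\<zero>\<^bsub>?Q\<^esub> = N +>\<^bsub>M\<^esub> \<zero>\<^bsub>M\<^esub>" by (simp add: zero_quotient coset_zero)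
  show "cring K" by (rule R.is_cring)
  show "abelian_group ?Q"
  proof (rule abelian_groupI)
    fix A assume "A \<in> carrier ?Q"
    then obtain x where x: "x \<in> carrier M" "A = N +>\<^bsub>M\<^esub> x" by (auto simp: carrier_quotient)
    then have "(N +>\<^bsub>M\<^esub> (\<ominus>\<^bsub>M\<^esub> x)) \<oplus>\<^bsub>?Q\<^esub> A = \<zero>\<^bsub>?Q\<^esub>"
      by (simp add: add_quotient zero M.l_neg)
    moreover have "N +>\<^bsub>M\<^esub> (\<ominus>\<^bsub>M\<^esub> x) \<in> carrier ?Q"
      using x by (simp add: carrier_quotient)
    ultimately show "\<exists>y\<in>carrier ?Q. y \<oplus>\<^bsub>?Q\<^esub> A = \<zero>\<^bsub>?Q\<^esub>" by blast
  qed (auto simp: carrier_quotient zero add_quotient M.a_ac)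
qed (auto simp: carrier_quotient add_quotient smult_quotient smult_l_distr smult_r_distr smult_assoc1)

end

text \<open>
  A biadditive operation that sends the given submodules into \<open>N\<close> is constant modulo \<open>N\<close> on
  pairs of cosets, so the union over all representatives is a single coset.
\<close>

lemma coset_biadditive:
  assumes A: "module_submodule K A NA" and B: "module_submodule K B NB"
    and M: "module_submodule K M N"
    and closed: "\<And>x y. \<lbrakk>x \<in> carrier A; y \<in> carrier B\<rbrakk> \<Longrightarrow> h x y \<in> carrier M"
    and add_left: "\<And>x x' y. \<lbrakk>x \<in> carrier A; x' \<in> carrier A; y \<in> carrier B\<rbrakk>
      \<Longrightarrow> h (x \<oplus>\<^bsub>A\<^esub> x') y = h x y \<oplus>\<^bsub>M\<^esub> h x' y"
    and add_right: "\<And>x y y'. \<lbrakk>x \<in> carrier A; y \<in> carrier B; y' \<in> carrier B\<rbrakk>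
      \<Longrightarrow> h x (y \<oplus>\<^bsub>B\<^esub> y') = h x y \<oplus>\<^bsub>M\<^esub> h x y'"
    and left: "\<And>x y. \<lbrakk>x \<in> NA; y \<in> carrier B\<rbrakk> \<Longrightarrow> h x y \<in> N"
    and right: "\<And>x y. \<lbrakk>x \<in> carrier A; y \<in> NB\<rbrakk> \<Longrightarrow> h x y \<in> N"
    and x: "x \<in> carrier A" and y: "y \<in> carrier B"
  shows "(\<Union>x'\<in>NA +>\<^bsub>A\<^esub> x. \<Union>y'\<in>NB +>\<^bsub>B\<^esub> y. N +>\<^bsub>M\<^esub> h x' y') = N +>\<^bsub>M\<^esub> h x y"
proof -
  interpret A: module_submodule K A NA by fact
  interpret B: module_submodule K B NB by fact
  interpret M: module_submodule K M N by fact
  have "N +>\<^bsub>M\<^esub> h x' y' = N +>\<^bsub>M\<^esub> h x y"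
    if x': "x' \<in> NA +>\<^bsub>A\<^esub> x" and y': "y' \<in> NB +>\<^bsub>B\<^esub> y" for x' y'
  proof -
    obtain i where i: "i \<in> NA" "x' = i \<oplus>\<^bsub>A\<^esub> x" using A.coset_cases[OF x'] .
    obtain j where j: "j \<in> NB" "y' = j \<oplus>\<^bsub>B\<^esub> y" using B.coset_cases[OF y'] .
    have ic: "i \<in> carrier A" and jc: "j \<in> carrier B"
      using i j A.N.a_Hcarr B.N.a_Hcarr by auto
    have y'c: "y' \<in> carrier B" using j jc y by simp
    have "h x' y' = h i y' \<oplus>\<^bsub>M\<^esub> h x y'"
      using i(2) add_left[OF ic x y'c] by simp
    also have "h x y' = h x j \<oplus>\<^bsub>M\<^esub> h x y"
      using j(2) add_right[OF x jc y] by simp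
    finally show ?thesis
      using left[OF i(1) y'c] right[OF x j(1)] closed x y jc by (simp add: M.coset_absorb)
  qed
  then show ?thesis
    using A.N.a_rcos_self[OF x] B.N.a_rcos_self[OF y] by (intro UN_eq_const)
qed


section \<open>Ideals of linear categories and quotient categories\<close>

lemma mors_iff [simp]: "(a, b, f) \<in> mors C \<longleftrightarrow> a \<in> Ob C \<and> b \<in> Ob C \<and> f \<in> carrier (Hom C a b)"
  by (simp add: mors_def)

lemma (in linear_category) cat_ideal_full: "cat_ideal K C (\<lambda>a b. carrier (Hom C a b))"
  by (simp add: cat_ideal_def hom_module Module.module.carrier_is_submodule comp_closed)

lemma cat_idealD:
  assumes "cat_ideal K C I"
  shows "\<lbrakk>a \<in> Ob C; b \<in> Ob C\<rbrakk> \<Longrightarrow> submodule (I a b) K (Hom C a b)"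
    and "\<lbrakk>a \<in> Ob C; b \<in> Ob C; c \<in> Ob C; f \<in> I a b; f \<in> carrier (Hom C a b); g \<in> carrier (Hom C b c)\<rbrakk>
      \<Longrightarrow> Comp C a b c g f \<in> I a c"
    and "\<lbrakk>a \<in> Ob C; b \<in> Ob C; c \<in> Ob C; f \<in> carrier (Hom C a b); g \<in> I b c; g \<in> carrier (Hom C b c)\<rbrakk>
      \<Longrightarrow> Comp C a b c g f \<in> I a c"
  using assms unfolding cat_ideal_def by blast+

lemma cat_idealI:
  assumes "\<And>a b. \<lbrakk>a \<in> Ob C; b \<in> Ob C\<rbrakk> \<Longrightarrow> submodule (I a b) K (Hom C a b)"
    and "\<And>a b c f g. \<lbrakk>a \<in> Ob C; b \<in> Ob C; c \<in> Ob C; f \<in> I a b; f \<in> carrier (Hom C a b);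
      g \<in> carrier (Hom C b c)\<rbrakk> \<Longrightarrow> Comp C a b c g f \<in> I a c"
    and "\<And>a b c f g. \<lbrakk>a \<in> Ob C; b \<in> Ob C; c \<in> Ob C; f \<in> carrier (Hom C a b); g \<in> I b c;
      g \<in> carrier (Hom C b c)\<rbrakk> \<Longrightarrow> Comp C a b c g f \<in> I a c"
  shows "cat_ideal K C I"
  using assms unfolding cat_ideal_def by blast

lemma cat_ideal_Inter:
  assumes C: "linear_category K C" and ne: "\<I> \<noteq> {}" and \<I>: "\<And>I. I \<in> \<I> \<Longrightarrow> cat_ideal K C I"
  shows "cat_ideal K C (\<lambda>a b. \<Inter>I\<in>\<I>. I a b)"
proof (rule cat_idealI)
  fix a b assume "a \<in> Ob C" "b \<in> Ob C"
  then show "submodule (\<Inter>I\<in>\<I>. I a b) K (Hom C a b)"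
    using ne cat_idealD(1)[OF \<I>] linear_category.hom_module[OF C]
    by (intro submodule_Inter) auto
qed (use cat_idealD(2,3)[OF \<I>] in auto)

lemma generated_ideal_Inter:
  "generated_ideal K C S = (\<lambda>a b. \<Inter>I\<in>{I. cat_ideal K C I \<and> (\<forall>(c, d, f)\<in>S. f \<in> I c d)}. I a b)"
  by (auto simp: generated_ideal_def fun_eq_iff)

text \<open>
  The intersection in the definition is over a nonempty family, as the ideal of all morphisms
  belongs to it; an empty intersection would be the whole type instead of an ideal.
\<close>

lemma generated_ideal_is_ideal:
  assumes C: "linear_category K C" and S: "S \<subseteq> mors C"
  shows "cat_ideal K C (generated_ideal K C S)"
proof -
  have "(\<lambda>a b. carrier (Hom C a b)) \<in> {I. cat_ideal K C I \<and> (\<forall>(c, d, f)\<in>S. f \<in> I c d)}"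
    using S linear_category.cat_ideal_full[OF C] by (auto simp: mors_def)
  then show ?thesis
    unfolding generated_ideal_Inter by (intro cat_ideal_Inter[OF C]) auto
qed

lemma generated_ideal_incl: "(a, b, f) \<in> S \<Longrightarrow> f \<in> generated_ideal K C S a b"
  by (auto simp: generated_ideal_def)

lemma generated_ideal_least:
  assumes "cat_ideal K C I" and "\<And>a b f. (a, b, f) \<in> S \<Longrightarrow> f \<in> I a b"
  shows "generated_ideal K C S a b \<subseteq> I a b"
  using assms unfolding generated_ideal_def
  by (intro Inter_lower CollectI exI[of _ I]) auto

text \<open>
  As for ordinary ideals, the family that is intersected contains the ideal of all morphisms, which
  is a tensor ideal because tensor products of morphisms are morphisms.
\<close>

lemma tensor_ideal_generated:
  assumes D: "linear_category K D" and S: "S \<subseteq> mors D"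
    and tens: "\<And>a b c d f g. \<lbrakk>(a, b, f) \<in> mors D; (c, d, g) \<in> mors D\<rbrakk>
      \<Longrightarrow> Tens D a b c d f g \<in> carrier (Hom D (TensOb D a c) (TensOb D b d))"
  shows "tensor_ideal K D (generated_tensor_ideal K D S)"
proof -
  let ?\<I> = "{I. tensor_ideal K D I \<and> (\<forall>(c, d, f)\<in>S. f \<in> I c d)}"
  have eq: "generated_tensor_ideal K D S = (\<lambda>a b. \<Inter>I\<in>?\<I>. I a b)"
    by (auto simp: generated_tensor_ideal_def fun_eq_iff)
  have "(\<lambda>a b. carrier (Hom D a b)) \<in> ?\<I>"
    using S tens linear_category.cat_ideal_full[OF D]
    by (auto simp: mors_def tensor_ideal_def)
  then have "cat_ideal K D (\<lambda>a b. \<Inter>I\<in>?\<I>. I a b)"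
    by (intro cat_ideal_Inter[OF D]) (auto simp: tensor_ideal_def)
  then show ?thesis
    unfolding eq by (auto simp: tensor_ideal_def)
qed

lemma generated_tensor_ideal_incl: "(a, b, f) \<in> S \<Longrightarrow> f \<in> generated_tensor_ideal K D S a b"
  by (auto simp: generated_tensor_ideal_def)

lemma generated_tensor_ideal_least:
  assumes "tensor_ideal K D I" and "\<And>a b f. (a, b, f) \<in> S \<Longrightarrow> f \<in> I a b"
  shows "generated_tensor_ideal K D S a b \<subseteq> I a b"
  using assms unfolding generated_tensor_ideal_def
  by (intro Inter_lower CollectI exI[of _ I]) auto

locale category_ideal = linear_category K C
  for K :: "('k, 'r) ring_scheme" and C :: "('k, 'o, 'm, 'z) lincat_scheme" +
  fixes I :: "'o \<Rightarrow> 'o \<Rightarrow> 'm set"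
  assumes ideal: "cat_ideal K C I"
begin

abbreviation coset :: "'o \<Rightarrow> 'o \<Rightarrow> 'm \<Rightarrow> 'm set" where
  "coset a b f \<equiv> I a b +>\<^bsub>Hom C a b\<^esub> f"

lemma module_submodule: "\<lbrakk>a \<in> Ob C; b \<in> Ob C\<rbrakk> \<Longrightarrow> module_submodule K (Hom C a b) (I a b)"
  by (simp add: module_submodule_def module_submodule_axioms_def hom_module cat_idealD(1)[OF ideal])

lemma ideal_subset: "\<lbrakk>a \<in> Ob C; b \<in> Ob C\<rbrakk> \<Longrightarrow> I a b \<subseteq> carrier (Hom C a b)"
  using cat_idealD(1)[OF ideal] hom_module Module.module.submoduleE(1) by blast

lemma Ob_quotient [simp]: "Ob (quotient_category C I) = Ob C"
  by (simp add: quotient_category_def)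

lemma Hom_quotient:
  "\<lbrakk>a \<in> Ob C; b \<in> Ob C\<rbrakk> \<Longrightarrow> carrier (Hom (quotient_category C I) a b) = coset a b ` carrier (Hom C a b)"
  using module_submodule.carrier_quotient[OF module_submodule] by (simp add: quotient_category_def)

lemma Ident_quotient: "Ident (quotient_category C I) a = coset a a (Ident C a)"
  by (simp add: quotient_category_def)

lemma coset_linear:
  "\<lbrakk>a \<in> Ob C; b \<in> Ob C\<rbrakk>
    \<Longrightarrow> linear_map K (Hom C a b) (Hom (quotient_category C I) a b) (coset a b)"
  using module_submodule.coset_linear_map[OF module_submodule] by (simp add: quotient_category_def)

lemma module_Hom_quotient:
  "\<lbrakk>a \<in> Ob C; b \<in> Ob C\<rbrakk> \<Longrightarrow> Module.module K (Hom (quotient_category C I) a b)"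
  using module_submodule.module_quotient[OF module_submodule] by (simp add: quotient_category_def)

text \<open>
  As a consequence, \<open>I\<close> lies in the preimage of every ideal of the quotient.
\<close>

lemma coset_in_ideal:
  "\<lbrakk>a \<in> Ob C; b \<in> Ob C; f \<in> I a b\<rbrakk> \<Longrightarrow> coset a b f = \<zero>\<^bsub>Hom (quotient_category C I) a b\<^esub>"
  using module_submodule.coset_absorb_zero[OF module_submodule] by (simp add: quotient_category_def)

lemma add_quotient:
  "\<lbrakk>(a, b, f) \<in> mors C; (a, b, g) \<in> mors C\<rbrakk>
    \<Longrightarrow> coset a b f \<oplus>\<^bsub>Hom (quotient_category C I) a b\<^esub> coset a b g = coset a b (f \<oplus>\<^bsub>Hom C a b\<^esub> g)"
  using linear_mapD(2)[OF coset_linear] by simp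

lemma smult_quotient:
  "\<lbrakk>k \<in> carrier K; (a, b, f) \<in> mors C\<rbrakk>
    \<Longrightarrow> k \<odot>\<^bsub>Hom (quotient_category C I) a b\<^esub> coset a b f = coset a b (k \<odot>\<^bsub>Hom C a b\<^esub> f)"
  using linear_mapD(3)[OF coset_linear] by simp

lemma Comp_quotient:
  assumes "(a, b, f) \<in> mors C" and "(b, c, g) \<in> mors C"
  shows "Comp (quotient_category C I) a b c (coset b c g) (coset a b f) = coset a c (Comp C a b c g f)"
  using assms unfolding quotient_category_def
  by (simp, intro coset_biadditive[where K = K])
    (auto intro: module_submodule comp_closed comp_add_left comp_add_right
      cat_idealD(2,3)[OF ideal] subsetD[OF ideal_subset])

lemma linear_category_quotient: "linear_category K (quotient_category C I)"
proof (rule linear_category.intro)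
  show "cring K" by (rule ground_ring)
  show "\<And>a b. \<lbrakk>a \<in> Ob (quotient_category C I); b \<in> Ob (quotient_category C I)\<rbrakk>
      \<Longrightarrow> Module.module K (Hom (quotient_category C I) a b)"
    by (simp add: module_Hom_quotient)
qed (auto simp: Hom_quotient Ident_quotient ident_closed Comp_quotient comp_closed
    comp_ident_right comp_ident_left comp_assoc add_quotient smult_quotient
    comp_add_left comp_add_right comp_smult_left comp_smult_right
    Module.module.smult_closed[OF hom_module] abelian_monoid.a_closed[OF abelian_group.axioms(1)[OF Module.module.axioms(2)[OF hom_module]]])

lemma coset_eq_iff:
  "\<lbrakk>(a, b, f) \<in> mors C; (a, b, g) \<in> mors C\<rbrakk>
    \<Longrightarrow> coset a b f = coset a b g \<longleftrightarrow> f \<ominus>\<^bsub>Hom C a b\<^esub> g \<in> I a b"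
  using module_submodule.coset_eq_iff[OF module_submodule] by simp

end

lemma linearly_isomorphic_trans:
  assumes "linearly_isomorphic K B C" and "linearly_isomorphic K C D"
  shows "linearly_isomorphic K B D"
proof -
  obtain F \<Phi> G \<Psi> where F: "linear_functor K B C F \<Phi>" "bijective_functor B C F \<Phi>"
    and G: "linear_functor K C D G \<Psi>" "bijective_functor C D G \<Psi>"
    using assms unfolding linearly_isomorphic_def by blast
  have FOb: "F a \<in> Ob C" if "a \<in> Ob B" for a
    using F(1) that by (auto simp: linear_functor_def)
  have \<Phi>: "\<Phi> a b f \<in> carrier (Hom C (F a) (F b))"
    if "a \<in> Ob B" "b \<in> Ob B" "f \<in> carrier (Hom B a b)" for a b f
    using F(1) that by (auto simp: linear_functor_def Pi_iff)
  have FG: "linear_functor K B D (\<lambda>a. G (F a)) (\<lambda>a b f. \<Psi> (F a) (F b) (\<Phi> a b f))"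
    using F(1) G(1) FOb \<Phi> unfolding linear_functor_def by (auto simp: Pi_iff)
  have "bij_betw (\<lambda>f. \<Psi> (F a) (F b) (\<Phi> a b f))
      (carrier (Hom B a b)) (carrier (Hom D (G (F a)) (G (F b))))"
    if "a \<in> Ob B" "b \<in> Ob B" for a b
  proof -
    have "bij_betw (\<Phi> a b) (carrier (Hom B a b)) (carrier (Hom C (F a) (F b)))"
      using F(2) that unfolding bijective_functor_def by blast
    moreover have "bij_betw (\<Psi> (F a) (F b)) (carrier (Hom C (F a) (F b)))
        (carrier (Hom D (G (F a)) (G (F b))))"
      using G(2) FOb[OF that(1)] FOb[OF that(2)] unfolding bijective_functor_def by blast
    ultimately show ?thesis by (rule bij_betw_trans[unfolded comp_def])
  qed
  moreover have "bij_betw (\<lambda>a. G (F a)) (Ob B) (Ob D)"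
    using F(2) G(2) unfolding bijective_functor_def
    by (blast intro: bij_betw_trans[unfolded comp_def])
  ultimately have "bijective_functor B D (\<lambda>a. G (F a)) (\<lambda>a b f. \<Psi> (F a) (F b) (\<Phi> a b f))"
    unfolding bijective_functor_def by blast
  with FG show ?thesis unfolding linearly_isomorphic_def by blast
qed

text \<open>
  Third isomorphism theorem. A morphism of the iterated quotient is a set of cosets of \<open>I\<close>, and
  the union of these cosets is a coset of \<open>P\<close>, the preimage of \<open>J\<close>.
\<close>

lemma (in category_ideal) iterated_quotient:
  assumes J: "cat_ideal K (quotient_category C I) J" and P: "cat_ideal K C P"
    and PJ: "\<And>a b f. (a, b, f) \<in> mors C \<Longrightarrow> f \<in> P a b \<longleftrightarrow> coset a b f \<in> J a b"
  shows "linearly_isomorphic K (quotient_category (quotient_category C I) J) (quotient_category C P)"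
proof -
  interpret CI: linear_category K "quotient_category C I" by (rule linear_category_quotient)
  interpret CIJ: category_ideal K "quotient_category C I" J by unfold_locales fact
  interpret CP: category_ideal K C P by unfold_locales fact
  let ?CI = "quotient_category C I"
  let ?D = "quotient_category ?CI J"
  have coset_mors: "(a, b, coset a b f) \<in> mors ?CI" if "(a, b, f) \<in> mors C" for a b f
    using that by (simp add: Hom_quotient)
  have minus: "coset a b f \<ominus>\<^bsub>Hom ?CI a b\<^esub> coset a b g = coset a b (f \<ominus>\<^bsub>Hom C a b\<^esub> g)"
    if "(a, b, f) \<in> mors C" "(a, b, g) \<in> mors C" for a b f g
    using that linear_map_minus[OF hom_module module_Hom_quotient coset_linear] by simp
  have diff: "(a, b, f \<ominus>\<^bsub>Hom C a b\<^esub> g) \<in> mors C"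
    if "(a, b, f) \<in> mors C" "(a, b, g) \<in> mors C" for a b f g
    using that abelian_group.minus_closed[OF Module.module.axioms(2)[OF hom_module]] by simp
  have eq_iff: "CIJ.coset a b (coset a b f) = CIJ.coset a b (coset a b g)
      \<longleftrightarrow> CP.coset a b f = CP.coset a b g"
    if "(a, b, f) \<in> mors C" "(a, b, g) \<in> mors C" for a b f g
    using that CIJ.coset_eq_iff[OF coset_mors coset_mors] CP.coset_eq_iff PJ[OF diff] minus
    by simp
  have Union_coset: "\<Union> (CIJ.coset a b (coset a b f)) = CP.coset a b f"
    if f: "(a, b, f) \<in> mors C" for a b f
  proof (rule Set.set_eqI)
    fix g
    have ab: "a \<in> Ob C" "b \<in> Ob C" using f by auto
    interpret I: module_submodule K "Hom C a b" "I a b" using ab by (rule module_submodule)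
    interpret P: module_submodule K "Hom C a b" "P a b" using ab by (rule CP.module_submodule)
    interpret J: module_submodule K "Hom ?CI a b" "J a b"
      using ab by (intro CIJ.module_submodule) auto
    have "g \<in> \<Union> (CIJ.coset a b (coset a b f))
        \<longleftrightarrow> g \<in> carrier (Hom C a b) \<and> coset a b g \<in> CIJ.coset a b (coset a b f)"
    proof
      assume "g \<in> \<Union> (CIJ.coset a b (coset a b f))"
      then obtain A where A: "A \<in> CIJ.coset a b (coset a b f)" "g \<in> A" by blast
      then have "A \<in> carrier (Hom ?CI a b)"
        using coset_mors[OF f] J.N.a_elemrcos_carrier by auto
      then obtain h where "h \<in> carrier (Hom C a b)" "A = coset a b h"
        using ab by (auto simp: Hom_quotient)
      with A show "g \<in> carrier (Hom C a b) \<and> coset a b g \<in> CIJ.coset a b (coset a b f)"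
        by (auto simp: I.mem_coset_iff)
    qed (use I.N.a_rcos_self in blast)
    also have "\<dots> \<longleftrightarrow> g \<in> CP.coset a b f"
      using f coset_mors eq_iff by (auto simp: J.mem_coset_iff P.mem_coset_iff)
    finally show "g \<in> \<Union> (CIJ.coset a b (coset a b f)) \<longleftrightarrow> g \<in> CP.coset a b f" .
  qed
  have Hom_D: "carrier (Hom ?D a b) = (\<lambda>f. CIJ.coset a b (coset a b f)) ` carrier (Hom C a b)"
    if "a \<in> Ob C" "b \<in> Ob C" for a b
    using that CIJ.Hom_quotient Hom_quotient by (simp add: image_image)
  have "linear_functor K ?D (quotient_category C P) (\<lambda>a. a) (\<lambda>a b A. \<Union> A)"
    unfolding linear_functor_def
    by (auto simp: Hom_D Union_coset CP.Hom_quotient CIJ.Ident_quotient Ident_quotient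
        CP.Ident_quotient ident_closed CIJ.Comp_quotient Comp_quotient CP.Comp_quotient
        comp_closed CIJ.add_quotient add_quotient CP.add_quotient
        CIJ.smult_quotient smult_quotient CP.smult_quotient Hom_quotient
        Module.module.smult_closed[OF hom_module] abelian_monoid.a_closed[OF abelian_group.axioms(1)[OF Module.module.axioms(2)[OF hom_module]]])
  moreover have "bijective_functor ?D (quotient_category C P) (\<lambda>a. a) (\<lambda>a b A. \<Union> A)"
    unfolding bijective_functor_def
    by (auto simp: bij_betw_def inj_on_def Hom_D Union_coset CP.Hom_quotient eq_iff image_image)
  ultimately show ?thesis unfolding linearly_isomorphic_def by blast
qed


section \<open>Free modules and bilinear extension\<close>

context cring
begin

lemma free_module_simps:
  "\<zero>\<^bsub>free_module R S\<^esub> = (\<lambda>s. \<zero>)"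
  "f \<oplus>\<^bsub>free_module R S\<^esub> g = (\<lambda>s. f s \<oplus> g s)"
  "k \<odot>\<^bsub>free_module R S\<^esub> f = (\<lambda>s. k \<otimes> f s)"
  by (simp_all add: free_module_def)

lemma free_module_iff:
  "f \<in> carrier (free_module R S) \<longleftrightarrow>
    (\<forall>s. f s \<in> carrier R) \<and> (\<forall>s. s \<notin> S \<longrightarrow> f s = \<zero>) \<and> finite {s. f s \<noteq> \<zero>}"
  by (simp add: free_module_def)

lemma free_module_zero_closed: "(\<lambda>s. \<zero>) \<in> carrier (free_module R S)"
  by (simp add: free_module_iff)

lemma free_module_add_closed:
  assumes "f \<in> carrier (free_module R S)" and "g \<in> carrier (free_module R S)"
  shows "(\<lambda>s. f s \<oplus> g s) \<in> carrier (free_module R S)"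
proof -
  have "finite ({s. f s \<noteq> \<zero>} \<union> {s. g s \<noteq> \<zero>})"
    using assms by (auto simp: free_module_iff)
  then have "finite {s. f s \<oplus> g s \<noteq> \<zero>}"
    by (rule rev_finite_subset) auto
  then show ?thesis
    using assms by (auto simp: free_module_iff)
qed

lemma free_module_smult_closed:
  assumes "k \<in> carrier R" and "f \<in> carrier (free_module R S)"
  shows "(\<lambda>s. k \<otimes> f s) \<in> carrier (free_module R S)"
proof -
  have "finite {s. f s \<noteq> \<zero>}"
    using assms by (auto simp: free_module_iff)
  then have "finite {s. k \<otimes> f s \<noteq> \<zero>}"
    using assms(1) by (rule_tac rev_finite_subset) auto
  then show ?thesis
    using assms by (auto simp: free_module_iff)
qed

lemma free_module_neg_closed:
  assumes "f \<in> carrier (free_module R S)"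
  shows "(\<lambda>s. \<ominus> f s) \<in> carrier (free_module R S)"
proof -
  have "finite {s. f s \<noteq> \<zero>}"
    using assms by (auto simp: free_module_iff)
  then have "finite {s. \<ominus> f s \<noteq> \<zero>}"
    by (rule rev_finite_subset) auto
  then show ?thesis
    using assms by (auto simp: free_module_iff)
qed

lemmas free_module_closed =
  free_module_zero_closed free_module_add_closed free_module_smult_closed free_module_neg_closed

lemma free_module_module: "Module.module R (free_module R S)"
proof (rule Module.moduleI)
  have val: "f s \<in> carrier R" if "f \<in> carrier (free_module R S)" for f s
    using that by (simp add: free_module_iff)
  show "cring R" by (rule is_cring)
  show "abelian_group (free_module R S)"
  proof (rule abelian_groupI)
    fix f assume f: "f \<in> carrier (free_module R S)"
    then have "(\<lambda>s. \<ominus> f s) \<oplus>\<^bsub>free_module R S\<^esub> f = \<zero>\<^bsub>free_module R S\<^esub>"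
      by (simp add: free_module_simps val l_neg)
    then show "\<exists>g\<in>carrier (free_module R S). g \<oplus>\<^bsub>free_module R S\<^esub> f = \<zero>\<^bsub>free_module R S\<^esub>"
      using free_module_neg_closed[OF f] by blast
  qed (simp_all add: free_module_simps free_module_closed val a_ac)
  show "\<one> \<odot>\<^bsub>free_module R S\<^esub> f = f" if "f \<in> carrier (free_module R S)" for f
    using val[OF that] by (simp add: free_module_simps)
  show "(a \<oplus> b) \<odot>\<^bsub>free_module R S\<^esub> f
      = a \<odot>\<^bsub>free_module R S\<^esub> f \<oplus>\<^bsub>free_module R S\<^esub> b \<odot>\<^bsub>free_module R S\<^esub> f"
    if "a \<in> carrier R" "b \<in> carrier R" "f \<in> carrier (free_module R S)" for a b f
    using that val by (simp add: free_module_simps l_distr)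
qed (simp_all add: free_module_simps free_module_closed, auto simp: free_module_iff r_distr m_assoc)

lemma basis_in_free_module: "s \<in> S \<Longrightarrow> basis_elt R s \<in> carrier (free_module R S)"
  using finite_subset[of "{t. basis_elt R s t \<noteq> \<zero>}" "{s}"]
  by (auto simp: free_module_iff basis_elt_def)

text \<open>Induction on the size of the support, splitting off one term.\<close>

lemma free_module_induct [consumes 1, case_names zero add smult basis]:
  assumes "f \<in> carrier (free_module R S)"
    and zero: "P (\<lambda>s. \<zero>)"
    and add: "\<And>f g. \<lbrakk>f \<in> carrier (free_module R S); g \<in> carrier (free_module R S); P f; P g\<rbrakk>
      \<Longrightarrow> P (\<lambda>s. f s \<oplus> g s)"
    and smult: "\<And>k f. \<lbrakk>k \<in> carrier R; f \<in> carrier (free_module R S); P f\<rbrakk> \<Longrightarrow> P (\<lambda>s. k \<otimes> f s)"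
    and basis: "\<And>s. s \<in> S \<Longrightarrow> P (basis_elt R s)"
  shows "P f"
  using assms(1)
proof (induction "card {s. f s \<noteq> \<zero>}" arbitrary: f)
  case 0
  then have "f = (\<lambda>s. \<zero>)" by (auto simp: free_module_iff)
  then show ?case using zero by simp
next
  case (Suc n)
  have f: "\<And>s. f s \<in> carrier R" "\<And>s. s \<notin> S \<Longrightarrow> f s = \<zero>" "finite {s. f s \<noteq> \<zero>}"
    using Suc.prems by (auto simp: free_module_iff)
  have "card {s. f s \<noteq> \<zero>} \<noteq> 0" using Suc.hyps(2) by linarith
  then have "{s. f s \<noteq> \<zero>} \<noteq> {}" by (metis card.empty)
  then obtain s where s: "f s \<noteq> \<zero>" by blast
  then have sS: "s \<in> S" using f(2) by blast
  define g where "g = f(s := \<zero>)"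
  have supp: "{t. g t \<noteq> \<zero>} = {t. f t \<noteq> \<zero>} - {s}" by (auto simp: g_def)
  have g: "g \<in> carrier (free_module R S)"
    using f supp by (auto simp: free_module_iff g_def)
  have "card {t. g t \<noteq> \<zero>} = n"
    unfolding supp using Suc.hyps(2)[symmetric] f(3) s by (simp add: card_Diff_singleton)
  then have "P g" using Suc.hyps(1)[OF _ g] by simp
  then have "P (\<lambda>t. (f s \<otimes> basis_elt R s t) \<oplus> g t)"
    using f(1) sS g basis_in_free_module[OF sS] by (intro add smult basis free_module_smult_closed) auto
  moreover have "(\<lambda>t. (f s \<otimes> basis_elt R s t) \<oplus> g t) = f"
    using f(1) by (auto simp: basis_elt_def fun_eq_iff g_def)
  ultimately show ?case by simp
qed

text \<open>
  The principle by which identities between linear operations are reduced to paths.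
\<close>

lemma linear_map_eqI:
  assumes N: "Module.module R N"
    and \<phi>: "linear_map R (free_module R S) N \<phi>" and \<psi>: "linear_map R (free_module R S) N \<psi>"
    and basis: "\<And>s. s \<in> S \<Longrightarrow> \<phi> (basis_elt R s) = \<psi> (basis_elt R s)"
    and f: "f \<in> carrier (free_module R S)"
  shows "\<phi> f = \<psi> f"
  using f
proof (induction rule: free_module_induct)
  case zero
  then show ?case
    using linear_map_zero[OF free_module_module N \<phi>] linear_map_zero[OF free_module_module N \<psi>]
    by (simp add: free_module_simps)
next
  case (add f g)
  then show ?case
    using linear_mapD(2)[OF \<phi>, of f g] linear_mapD(2)[OF \<psi>, of f g] by (simp add: free_module_simps)
next
  case (smult k f)
  then show ?case
    using linear_mapD(3)[OF \<phi>, of k f] linear_mapD(3)[OF \<psi>, of k f] by (simp add: free_module_simps)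
qed (rule basis)

text \<open>
  The sum over the exact supports may be replaced by a sum over any larger finite sets. This makes
  sums for different arguments comparable.
\<close>

lemma bilinear_extension_eq:
  assumes f: "f \<in> carrier (free_module R S)" and g: "g \<in> carrier (free_module R T)"
    and A: "finite A" "{s. f s \<noteq> \<zero>} \<subseteq> A" and B: "finite B" "{t. g t \<noteq> \<zero>} \<subseteq> B"
  shows "bilinear_extension R m f g u =
    (\<Oplus>st\<in>A \<times> B. if m (fst st) (snd st) = u then f (fst st) \<otimes> g (snd st) else \<zero>)"
proof -
  let ?Z = "{(s, t). f s \<noteq> \<zero> \<and> g t \<noteq> \<zero> \<and> m s t = u}"
  let ?h = "\<lambda>st. if m (fst st) (snd st) = u then f (fst st) \<otimes> g (snd st) else \<zero>"
  have c: "\<And>s. f s \<in> carrier R" "\<And>t. g t \<in> carrier R"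
    using f g by (auto simp: free_module_iff)
  have "bilinear_extension R m f g u = (\<Oplus>st\<in>?Z. ?h st)"
    unfolding bilinear_extension_def using c by (intro finsum_cong'[OF refl]) auto
  also have "\<dots> = (\<Oplus>st\<in>A \<times> B. ?h st)"
    using A B c by (intro add.finprod_mono_neutral_cong_left) auto
  finally show ?thesis .
qed

lemma bilinear_extension_closed:
  assumes f: "f \<in> carrier (free_module R S)" and g: "g \<in> carrier (free_module R T)"
    and m: "\<And>s t. \<lbrakk>s \<in> S; t \<in> T\<rbrakk> \<Longrightarrow> m s t \<in> U"
  shows "bilinear_extension R m f g \<in> carrier (free_module R U)"
proof -
  have c: "\<And>s. f s \<in> carrier R" "\<And>t. g t \<in> carrier R" "\<And>s. s \<notin> S \<Longrightarrow> f s = \<zero>" "\<And>t. t \<notin> T \<Longrightarrow> g t = \<zero>"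
    and fin: "finite {s. f s \<noteq> \<zero>}" "finite {t. g t \<noteq> \<zero>}"
    using f g by (auto simp: free_module_iff)
  let ?Z = "\<lambda>u. {(s, t). f s \<noteq> \<zero> \<and> g t \<noteq> \<zero> \<and> m s t = u}"
  have empty: "bilinear_extension R m f g u = \<zero>" if "?Z u = {}" for u
    unfolding bilinear_extension_def that by simp
  have "{u. bilinear_extension R m f g u \<noteq> \<zero>} \<subseteq> (\<lambda>(s, t). m s t) ` ({s. f s \<noteq> \<zero>} \<times> {t. g t \<noteq> \<zero>})"
  proof
    fix u assume "u \<in> {u. bilinear_extension R m f g u \<noteq> \<zero>}"
    then have "?Z u \<noteq> {}" using empty by blast
    then obtain s t where "f s \<noteq> \<zero>" "g t \<noteq> \<zero>" "m s t = u" by blast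
    then show "u \<in> (\<lambda>(s, t). m s t) ` ({s. f s \<noteq> \<zero>} \<times> {t. g t \<noteq> \<zero>})" by force
  qed
  then have "finite {u. bilinear_extension R m f g u \<noteq> \<zero>}"
    using fin by (meson finite_SigmaI finite_imageI finite_subset)
  moreover have "bilinear_extension R m f g u \<in> carrier R" for u
    unfolding bilinear_extension_def using c by (intro finsum_closed) auto
  moreover have "bilinear_extension R m f g u = \<zero>" if "u \<notin> U" for u
  proof (rule empty)
    show "?Z u = {}" using m that c(3,4) by blast
  qed
  ultimately show ?thesis by (simp add: free_module_iff)
qed

lemma bilinear_extension_linear_left:
  assumes g: "g \<in> carrier (free_module R T)" and m: "\<And>s t. \<lbrakk>s \<in> S; t \<in> T\<rbrakk> \<Longrightarrow> m s t \<in> U"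
  shows "linear_map R (free_module R S) (free_module R U) (\<lambda>f. bilinear_extension R m f g)"
proof (rule linear_mapI)
  have B: "finite {t. g t \<noteq> \<zero>}" "\<And>t. g t \<in> carrier R" using g by (auto simp: free_module_iff)
  fix f f' assume f: "f \<in> carrier (free_module R S)" and f': "f' \<in> carrier (free_module R S)"
  let ?A = "{s. f s \<noteq> \<zero>} \<union> {s. f' s \<noteq> \<zero>}"
  have A: "finite ?A" "\<And>s. f s \<in> carrier R" "\<And>s. f' s \<in> carrier R"
    using f f' by (auto simp: free_module_iff)
  have sub: "{s. f s \<oplus> f' s \<noteq> \<zero>} \<subseteq> ?A" by auto
  show "bilinear_extension R m (f \<oplus>\<^bsub>free_module R S\<^esub> f') g
      = bilinear_extension R m f g \<oplus>\<^bsub>free_module R U\<^esub> bilinear_extension R m f' g"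
  proof
    fix u
    let ?h = "\<lambda>f st. if m (fst st) (snd st) = u then f (fst st) \<otimes> g (snd st) else \<zero>"
    have "bilinear_extension R m (\<lambda>s. f s \<oplus> f' s) g u
        = (\<Oplus>st\<in>?A \<times> {t. g t \<noteq> \<zero>}. ?h (\<lambda>s. f s \<oplus> f' s) st)"
      using free_module_add_closed[OF f f'] g A(1) sub B(1)
      by (intro bilinear_extension_eq) auto
    also have "\<dots> = (\<Oplus>st\<in>?A \<times> {t. g t \<noteq> \<zero>}. ?h f st \<oplus> ?h f' st)"
      using A B by (intro finsum_cong'[OF refl]) (auto simp: l_distr)
    also have "\<dots> = (\<Oplus>st\<in>?A \<times> {t. g t \<noteq> \<zero>}. ?h f st) \<oplus> (\<Oplus>st\<in>?A \<times> {t. g t \<noteq> \<zero>}. ?h f' st)"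
      using A B by (intro finsum_addf) auto
    also have "\<dots> = bilinear_extension R m f g u \<oplus> bilinear_extension R m f' g u"
      using bilinear_extension_eq[OF f g A(1) _ B(1), of m u]
        bilinear_extension_eq[OF f' g A(1) _ B(1), of m u] by simp
    finally show "bilinear_extension R m (f \<oplus>\<^bsub>free_module R S\<^esub> f') g u
      = (bilinear_extension R m f g \<oplus>\<^bsub>free_module R U\<^esub> bilinear_extension R m f' g) u"
      by (simp add: free_module_simps)
  qed
next
  have B: "finite {t. g t \<noteq> \<zero>}" "\<And>t. g t \<in> carrier R" using g by (auto simp: free_module_iff)
  fix k f assume k: "k \<in> carrier R" and f: "f \<in> carrier (free_module R S)"
  let ?A = "{s. f s \<noteq> \<zero>}"
  have A: "finite ?A" "\<And>s. f s \<in> carrier R" using f by (auto simp: free_module_iff)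
  have sub: "{s. k \<otimes> f s \<noteq> \<zero>} \<subseteq> ?A" using k by auto
  show "bilinear_extension R m (k \<odot>\<^bsub>free_module R S\<^esub> f) g
      = k \<odot>\<^bsub>free_module R U\<^esub> bilinear_extension R m f g"
  proof
    fix u
    let ?h = "\<lambda>f st. if m (fst st) (snd st) = u then f (fst st) \<otimes> g (snd st) else \<zero>"
    have "bilinear_extension R m (\<lambda>s. k \<otimes> f s) g u
        = (\<Oplus>st\<in>?A \<times> {t. g t \<noteq> \<zero>}. ?h (\<lambda>s. k \<otimes> f s) st)"
      using free_module_smult_closed[OF k f] g A(1) sub B(1)
      by (intro bilinear_extension_eq) auto
    also have "\<dots> = (\<Oplus>st\<in>?A \<times> {t. g t \<noteq> \<zero>}. k \<otimes> ?h f st)"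
      using A B k by (intro finsum_cong'[OF refl]) (auto simp: m_assoc)
    also have "\<dots> = k \<otimes> (\<Oplus>st\<in>?A \<times> {t. g t \<noteq> \<zero>}. ?h f st)"
      using A B k by (intro finsum_rdistr[symmetric]) auto
    also have "\<dots> = k \<otimes> bilinear_extension R m f g u"
      using bilinear_extension_eq[OF f g A(1) _ B(1), of m u] by simp
    finally show "bilinear_extension R m (k \<odot>\<^bsub>free_module R S\<^esub> f) g u
      = (k \<odot>\<^bsub>free_module R U\<^esub> bilinear_extension R m f g) u"
      by (simp add: free_module_simps)
  qed
qed (use bilinear_extension_closed g m in blast)

text \<open>
  Linearity in the second factor is obtained from linearity in the first by exchanging the
  factors.
\<close>

lemma bilinear_extension_flip:
  assumes f: "f \<in> carrier (free_module R S)" and g: "g \<in> carrier (free_module R T)"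
  shows "bilinear_extension R m f g = bilinear_extension R (\<lambda>t s. m s t) g f"
proof
  fix u
  let ?Z = "{(s, t). f s \<noteq> \<zero> \<and> g t \<noteq> \<zero> \<and> m s t = u}"
  let ?Z' = "{(t, s). g t \<noteq> \<zero> \<and> f s \<noteq> \<zero> \<and> m s t = u}"
  have c: "\<And>s. f s \<in> carrier R" "\<And>t. g t \<in> carrier R"
    using f g by (auto simp: free_module_iff)
  have Z: "?Z = prod.swap ` ?Z'" by auto
  have "(\<Oplus>st\<in>prod.swap ` ?Z'. f (fst st) \<otimes> g (snd st)) = (\<Oplus>ts\<in>?Z'. f (snd ts) \<otimes> g (fst ts))"
    using c by (subst finsum_reindex) (auto simp: inj_on_def)
  also have "\<dots> = (\<Oplus>ts\<in>?Z'. g (fst ts) \<otimes> f (snd ts))"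
    using c by (intro finsum_cong'[OF refl]) (auto simp: m_comm)
  finally show "bilinear_extension R m f g u = bilinear_extension R (\<lambda>t s. m s t) g f u"
    by (simp add: bilinear_extension_def Z)
qed

lemma bilinear_extension_linear_right:
  assumes f: "f \<in> carrier (free_module R S)" and m: "\<And>s t. \<lbrakk>s \<in> S; t \<in> T\<rbrakk> \<Longrightarrow> m s t \<in> U"
  shows "linear_map R (free_module R T) (free_module R U) (\<lambda>g. bilinear_extension R m f g)"
proof -
  have lin: "linear_map R (free_module R T) (free_module R U)
      (\<lambda>g. bilinear_extension R (\<lambda>t s. m s t) g f)"
    using bilinear_extension_linear_left[OF f, of T "\<lambda>t s. m s t" U] m by blast
  have eq: "bilinear_extension R m f g = bilinear_extension R (\<lambda>t s. m s t) g f"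
    if "g \<in> carrier (free_module R T)" for g
    using bilinear_extension_flip[OF f that] .
  show ?thesis
    using lin unfolding linear_map_def
    by (auto simp: eq module_add_closed[OF free_module_module]
        module.smult_closed[OF free_module_module] Pi_iff)
qed

lemma bilinear_extension_basis:
  "bilinear_extension R m (basis_elt R s) (basis_elt R t) = basis_elt R (m s t)"
proof
  fix u
  have "bilinear_extension R m (basis_elt R s) (basis_elt R t) u =
    (\<Oplus>st\<in>{s} \<times> {t}. if m (fst st) (snd st) = u
      then basis_elt R s (fst st) \<otimes> basis_elt R t (snd st) else \<zero>)"
    by (intro bilinear_extension_eq[where S = UNIV and T = UNIV] basis_in_free_module)
      (auto simp: basis_elt_def)
  also have "\<dots> = basis_elt R (m s t) u"
    by (simp add: basis_elt_def)
  finally show "bilinear_extension R m (basis_elt R s) (basis_elt R t) u = basis_elt R (m s t) u" .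
qed

text \<open>
  Two ways to combine three factors agree once they agree on basis elements: both sides are
  linear in each factor.
\<close>

lemma bilinear_extension_assoc:
  assumes m1: "\<And>s t. \<lbrakk>s \<in> S; t \<in> T\<rbrakk> \<Longrightarrow> m1 s t \<in> A"
    and m2: "\<And>a u. \<lbrakk>a \<in> A; u \<in> U\<rbrakk> \<Longrightarrow> m2 a u \<in> Z"
    and m3: "\<And>t u. \<lbrakk>t \<in> T; u \<in> U\<rbrakk> \<Longrightarrow> m3 t u \<in> B"
    and m4: "\<And>s b. \<lbrakk>s \<in> S; b \<in> B\<rbrakk> \<Longrightarrow> m4 s b \<in> Z"
    and eq: "\<And>s t u. \<lbrakk>s \<in> S; t \<in> T; u \<in> U\<rbrakk> \<Longrightarrow> m2 (m1 s t) u = m4 s (m3 t u)"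
    and f: "f \<in> carrier (free_module R S)" and g: "g \<in> carrier (free_module R T)"
    and h: "h \<in> carrier (free_module R U)"
  shows "bilinear_extension R m2 (bilinear_extension R m1 f g) h
    = bilinear_extension R m4 f (bilinear_extension R m3 g h)"
proof -
  note left = bilinear_extension_linear_left and right = bilinear_extension_linear_right
  note closed = bilinear_extension_closed and basis = basis_in_free_module
  have 1: "bilinear_extension R m2 (bilinear_extension R m1 (basis_elt R s) (basis_elt R t)) h
    = bilinear_extension R m4 (basis_elt R s) (bilinear_extension R m3 (basis_elt R t) h)"
    if "s \<in> S" "t \<in> T" "h \<in> carrier (free_module R U)" for s t h
  proof (rule linear_map_eqI[OF free_module_module _ _ _ that(3)])
    show "linear_map R (free_module R U) (free_module R Z)
      (\<lambda>h. bilinear_extension R m2 (bilinear_extension R m1 (basis_elt R s) (basis_elt R t)) h)"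
      by (rule right[OF closed[OF basis[OF that(1)] basis[OF that(2)]]]) (fact m1, fact m2)
    show "linear_map R (free_module R U) (free_module R Z)
      (\<lambda>h. bilinear_extension R m4 (basis_elt R s) (bilinear_extension R m3 (basis_elt R t) h))"
      by (rule linear_map_comp[OF right[OF basis[OF that(2)]] right[OF basis[OF that(1)]]])
        (fact m3, fact m4)
  qed (simp add: bilinear_extension_basis eq that)
  have 2: "bilinear_extension R m2 (bilinear_extension R m1 (basis_elt R s) g) h
    = bilinear_extension R m4 (basis_elt R s) (bilinear_extension R m3 g h)"
    if "s \<in> S" "g \<in> carrier (free_module R T)" "h \<in> carrier (free_module R U)" for s g h
  proof (rule linear_map_eqI[OF free_module_module _ _ _ that(2)])
    show "linear_map R (free_module R T) (free_module R Z)
      (\<lambda>g. bilinear_extension R m2 (bilinear_extension R m1 (basis_elt R s) g) h)"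
      by (rule linear_map_comp[OF right[OF basis[OF that(1)]] left[OF that(3)]])
        (fact m1, fact m2)
    show "linear_map R (free_module R T) (free_module R Z)
      (\<lambda>g. bilinear_extension R m4 (basis_elt R s) (bilinear_extension R m3 g h))"
      by (rule linear_map_comp[OF left[OF that(3)] right[OF basis[OF that(1)]]])
        (fact m3, fact m4)
  qed (simp add: 1 that)
  show ?thesis
  proof (rule linear_map_eqI[OF free_module_module _ _ _ f])
    show "linear_map R (free_module R S) (free_module R Z)
      (\<lambda>f. bilinear_extension R m2 (bilinear_extension R m1 f g) h)"
      by (rule linear_map_comp[OF left[OF g] left[OF h]]) (fact m1, fact m2)
    show "linear_map R (free_module R S) (free_module R Z)
      (\<lambda>f. bilinear_extension R m4 f (bilinear_extension R m3 g h))"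
      by (rule left[OF closed[OF g h]]) (fact m3, fact m4)
  qed (simp add: 2 g h)
qed

end


section \<open>The free linear category\<close>

lemma free_lincat_simps [simp]:
  "Ob (free_lincat K Q) = verts Q"
  "Hom (free_lincat K Q) a b = free_module K (paths Q a b)"
  "Comp (free_lincat K Q) a b c = bilinear_extension K (\<lambda>q p. p @ q)"
  "Ident (free_lincat K Q) a = basis_elt K []"
  by (simp_all add: free_lincat_def)

lemma (in wf_digraph) paths_append: "\<lbrakk>p \<in> paths G a b; q \<in> paths G b c\<rbrakk> \<Longrightarrow> p @ q \<in> paths G a c"
  by (auto simp: paths_def intro: awalk_appendI)

lemma Nil_in_paths: "a \<in> verts G \<Longrightarrow> [] \<in> paths G a a"
  by (simp add: paths_def pre_digraph.awalk_def pre_digraph.cas.simps)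

lemma free_lincat_linear_category:
  assumes K: "cring K" and Q: "wf_digraph Q"
  shows "linear_category K (free_lincat K Q)"
proof -
  interpret K: cring K by fact
  interpret Q: wf_digraph Q by fact
  note append = Q.paths_append
  have left: "linear_map K (free_module K (paths Q b c)) (free_module K (paths Q a c))
      (\<lambda>g. bilinear_extension K (\<lambda>q p. p @ q) g f)"
    if "f \<in> carrier (free_module K (paths Q a b))" for a b c f
    using that append by (rule K.bilinear_extension_linear_left)
  have right: "linear_map K (free_module K (paths Q a b)) (free_module K (paths Q a c))
      (\<lambda>f. bilinear_extension K (\<lambda>q p. p @ q) g f)"
    if "g \<in> carrier (free_module K (paths Q b c))" for a b c g
    using that append by (rule K.bilinear_extension_linear_right)
  show ?thesis
  proof (rule linear_category.intro)
    fix a b f assume f: "(a, b, f) \<in> mors (free_lincat K Q)"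
    then have a: "a \<in> verts Q" and b: "b \<in> verts Q"
      and f: "f \<in> carrier (free_module K (paths Q a b))" by auto
    have "bilinear_extension K (\<lambda>q p. p @ q) f (basis_elt K []) = f"
      by (rule K.linear_map_eqI[OF K.free_module_module
            left[OF K.basis_in_free_module[OF Nil_in_paths[OF a]]] linear_map_id _ f])
        (simp add: K.bilinear_extension_basis)
    then show "Comp (free_lincat K Q) a a b f (Ident (free_lincat K Q) a) = f"
      by simp
    have "bilinear_extension K (\<lambda>q p. p @ q) (basis_elt K []) f = f"
      by (rule K.linear_map_eqI[OF K.free_module_module
            right[OF K.basis_in_free_module[OF Nil_in_paths[OF b]]] linear_map_id _ f])
        (simp add: K.bilinear_extension_basis)
    then show "Comp (free_lincat K Q) a b b (Ident (free_lincat K Q) b) f = f"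
      by simp
  next
    fix a b c d f g h
    assume "(a, b, f) \<in> mors (free_lincat K Q)" "(b, c, g) \<in> mors (free_lincat K Q)"
      "(c, d, h) \<in> mors (free_lincat K Q)"
    then show "Comp (free_lincat K Q) a b d (Comp (free_lincat K Q) b c d h g) f
        = Comp (free_lincat K Q) a c d h (Comp (free_lincat K Q) a b c g f)"
      using K.bilinear_extension_assoc[of "paths Q c d" "paths Q b c" "\<lambda>q p. p @ q" "paths Q b d"
          "paths Q a b" "\<lambda>q p. p @ q" "paths Q a d" "\<lambda>q p. p @ q" "paths Q a c" "\<lambda>q p. p @ q" h g f]
      by (simp add: append)
  next
    fix a b c f g assume *: "(a, b, f) \<in> mors (free_lincat K Q)"
      "(b, c, g) \<in> mors (free_lincat K Q)"
    show "Comp (free_lincat K Q) a b c g f \<in> carrier (Hom (free_lincat K Q) a c)"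
      using * linear_mapD(1)[OF left[of f a b c], of g] by simp
    show "Comp (free_lincat K Q) a b c (k \<odot>\<^bsub>Hom (free_lincat K Q) b c\<^esub> g) f
        = k \<odot>\<^bsub>Hom (free_lincat K Q) a c\<^esub> Comp (free_lincat K Q) a b c g f"
      if "k \<in> carrier K" for k
      using * that linear_mapD(3)[OF left[of f a b c], of k g] by simp
    show "Comp (free_lincat K Q) a b c g (k \<odot>\<^bsub>Hom (free_lincat K Q) a b\<^esub> f)
        = k \<odot>\<^bsub>Hom (free_lincat K Q) a c\<^esub> Comp (free_lincat K Q) a b c g f"
      if "k \<in> carrier K" for k
      using * that linear_mapD(3)[OF right[of g b c a], of k f] by simp
    show "Comp (free_lincat K Q) a b c (g \<oplus>\<^bsub>Hom (free_lincat K Q) b c\<^esub> g') f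
        = Comp (free_lincat K Q) a b c g f \<oplus>\<^bsub>Hom (free_lincat K Q) a c\<^esub>
          Comp (free_lincat K Q) a b c g' f"
      if "(b, c, g') \<in> mors (free_lincat K Q)" for g'
      using * that linear_mapD(2)[OF left[of f a b c], of g g'] by simp
    show "Comp (free_lincat K Q) a b c g (f \<oplus>\<^bsub>Hom (free_lincat K Q) a b\<^esub> f')
        = Comp (free_lincat K Q) a b c g f \<oplus>\<^bsub>Hom (free_lincat K Q) a c\<^esub>
          Comp (free_lincat K Q) a b c g f'"
      if "(a, b, f') \<in> mors (free_lincat K Q)" for f'
      using * that linear_mapD(2)[OF right[of g b c a], of f f'] by simp
  qed (use K in \<open>simp_all add: K.free_module_module K.basis_in_free_module Nil_in_paths\<close>)
qed


section \<open>Whiskering\<close>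

text \<open>
  The linear extension of whiskering of paths. It is written as a bilinear extension whose first
  factor is the generator of the free module on one element, so that the facts about bilinear
  extensions apply to it.
\<close>

definition whisker_map ::
  "('k, 'r) ring_scheme \<Rightarrow> 'x list \<Rightarrow> 'x list \<Rightarrow> (('x list \<times> 'e \<times> 'x list) list \<Rightarrow> 'k)
    \<Rightarrow> ('x list \<times> 'e \<times> 'x list) list \<Rightarrow> 'k" where
  "whisker_map K a b f = bilinear_extension K (\<lambda>_ p. whisker a b p) (basis_elt K ()) f"

lemma whisker_simps [simp]:
  "whisker a b [] = []"
  "whisker a b ((v, e, w) # p) = (a @ v, e, w @ b) # whisker a b p"
  "whisker a b (p @ q) = whisker a b p @ whisker a b q"
  by (simp_all add: whisker_def)

lemma whisker_whisker: "whisker a b (whisker a' b' p) = whisker (a @ a') (b' @ b) p"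
  by (auto simp: whisker_def)

lemma whisker_Nil_Nil: "whisker [] [] p = p"
  by (induction p) auto

locale free_monoid_quiver =
  K: cring K + Q: wf_digraph Q
  for K :: "('k, 'r) ring_scheme" and Q :: "('x list, 'e) pre_digraph" +
  fixes X :: "'x set"
  assumes verts_Q: "verts Q = lists X"
begin

abbreviation L where "L \<equiv> free_lincat K (bar_quiver Q)"
abbreviation W where "W \<equiv> whisker_map K"
abbreviation PT where "PT a b \<equiv> paths (bar_quiver Q) a b"
abbreviation comp where "comp \<equiv> bilinear_extension K (\<lambda>q p :: ('x list \<times> 'e \<times> 'x list) list. p @ q)"

lemma verts_append: "a @ b \<in> verts Q \<longleftrightarrow> a \<in> verts Q \<and> b \<in> verts Q"
  by (simp add: verts_Q)

lemma verts_Nil: "[] \<in> verts Q"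
  by (simp add: verts_Q)

lemma bar_quiver_simps:
  "verts (bar_quiver Q) = verts Q"
  "arcs (bar_quiver Q) = verts Q \<times> arcs Q \<times> verts Q"
  "tail (bar_quiver Q) (v, e, w) = v @ tail Q e @ w"
  "head (bar_quiver Q) (v, e, w) = v @ head Q e @ w"
  by (simp_all add: bar_quiver_def)

lemma wf_bar_quiver: "wf_digraph (bar_quiver Q)"
  by unfold_locales (auto simp: bar_quiver_simps verts_append)

sublocale L: linear_category K L
  by (rule free_lincat_linear_category[OF K.is_cring wf_bar_quiver])

lemma Nil_PT: "a \<in> verts Q \<Longrightarrow> [] \<in> PT a a"
  by (simp add: Nil_in_paths bar_quiver_simps)

lemma Cons_PT:
  "(v, e, w) # p \<in> PT a b \<longleftrightarrow>
    v \<in> verts Q \<and> e \<in> arcs Q \<and> w \<in> verts Q \<and> a = v @ tail Q e @ w \<and> p \<in> PT (v @ head Q e @ w) b"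
  using wf_digraph.head_in_verts[OF Q.wf_digraph_axioms] wf_digraph.tail_in_verts[OF Q.wf_digraph_axioms]
  by (auto simp: paths_def pre_digraph.awalk_def pre_digraph.cas.simps bar_quiver_simps verts_append)

lemma whisker_PT:
  assumes "a \<in> verts Q" and "b \<in> verts Q" and "p \<in> PT c d"
  shows "whisker a b p \<in> PT (a @ c @ b) (a @ d @ b)"
  using assms(3)
proof (induction p arbitrary: c)
  case Nil
  then have "c = d" "c \<in> verts Q"
    by (auto simp: paths_def pre_digraph.awalk_def pre_digraph.cas.simps bar_quiver_simps)
  then show ?case using assms by (simp add: Nil_PT verts_append)
next
  case (Cons \<alpha> p)
  obtain v e w where \<alpha>: "\<alpha> = (v, e, w)" by (cases \<alpha>)
  show ?case
    using Cons.prems Cons.IH[of "v @ head Q e @ w"] assms(1,2) unfolding \<alpha>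
    by (simp add: Cons_PT verts_append)
qed

lemma W_linear:
  assumes "a \<in> verts Q" and "b \<in> verts Q"
  shows "linear_map K (free_module K (PT c d)) (free_module K (PT (a @ c @ b) (a @ d @ b))) (W a b)"
  unfolding whisker_map_def
  by (rule K.bilinear_extension_linear_right[OF K.basis_in_free_module[of _ UNIV]])
    (auto intro: whisker_PT assms)

lemma W_basis: "W a b (basis_elt K p) = basis_elt K (whisker a b p)"
  by (simp add: whisker_map_def K.bilinear_extension_basis)

lemma append_PT: "\<lbrakk>q \<in> PT b c; p \<in> PT a b\<rbrakk> \<Longrightarrow> p @ q \<in> PT a c"
  using wf_digraph.paths_append[OF wf_bar_quiver] by blast

lemmas comp_left = K.bilinear_extension_linear_left[where m = "\<lambda>q p. p @ q", OF _ append_PT]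
lemmas comp_right = K.bilinear_extension_linear_right[where m = "\<lambda>q p. p @ q", OF _ append_PT]

text \<open>
  Operations on two morphisms, such as composites and tensor products, are compared on pairs of
  paths.
\<close>

lemma linear_map_eq_on_two:
  assumes N: "Module.module K N"
    and "\<And>g. g \<in> carrier (free_module K T) \<Longrightarrow> linear_map K (free_module K S) N (\<lambda>f. \<phi> f g)"
    and "\<And>g. g \<in> carrier (free_module K T) \<Longrightarrow> linear_map K (free_module K S) N (\<lambda>f. \<psi> f g)"
    and "\<And>f. f \<in> carrier (free_module K S) \<Longrightarrow> linear_map K (free_module K T) N (\<lambda>g. \<phi> f g)"
    and "\<And>f. f \<in> carrier (free_module K S) \<Longrightarrow> linear_map K (free_module K T) N (\<lambda>g. \<psi> f g)"
    and "\<And>s t. \<lbrakk>s \<in> S; t \<in> T\<rbrakk> \<Longrightarrow> \<phi> (basis_elt K s) (basis_elt K t) = \<psi> (basis_elt K s) (basis_elt K t)"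
    and f: "f \<in> carrier (free_module K S)" and g: "g \<in> carrier (free_module K T)"
  shows "\<phi> f g = \<psi> f g"
proof (rule K.linear_map_eqI[OF N assms(2)[OF g] assms(3)[OF g] _ f])
  fix s assume s: "s \<in> S"
  show "\<phi> (basis_elt K s) g = \<psi> (basis_elt K s) g"
    by (rule K.linear_map_eqI[OF N assms(4,5)[OF K.basis_in_free_module[OF s]] _ g])
      (rule assms(6)[OF s])
qed

lemma W_comp:
  assumes a: "a \<in> verts Q" and b: "b \<in> verts Q"
    and f: "f \<in> carrier (free_module K (PT c d))" and g: "g \<in> carrier (free_module K (PT d e))"
  shows "W a b (comp g f) = comp (W a b g) (W a b f)"
proof (rule linear_map_eq_on_two[OF _ _ _ _ _ _ g f,
      where \<phi> = "\<lambda>g f. W a b (comp g f)" and \<psi> = "\<lambda>g f. comp (W a b g) (W a b f)"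
        and N = "free_module K (PT (a @ c @ b) (a @ e @ b))"])
  note W = W_linear[OF a b]
  note W_closed = linear_mapD(1)[OF W]
  show "Module.module K (free_module K (PT (a @ c @ b) (a @ e @ b)))"
    by (rule K.free_module_module)
  fix f assume f: "f \<in> carrier (free_module K (PT c d))"
  show "linear_map K (free_module K (PT d e)) (free_module K (PT (a @ c @ b) (a @ e @ b)))
      (\<lambda>g. W a b (comp g f))"
    by (rule linear_map_comp[OF comp_left[OF f] W])
  show "linear_map K (free_module K (PT d e)) (free_module K (PT (a @ c @ b) (a @ e @ b)))
      (\<lambda>g. comp (W a b g) (W a b f))"
    by (rule linear_map_comp[OF W comp_left[OF W_closed[OF f]]])
next
  note W = W_linear[OF a b]
  note W_closed = linear_mapD(1)[OF W]
  fix g assume g: "g \<in> carrier (free_module K (PT d e))"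
  show "linear_map K (free_module K (PT c d)) (free_module K (PT (a @ c @ b) (a @ e @ b)))
      (\<lambda>f. W a b (comp g f))"
    by (rule linear_map_comp[OF comp_right[OF g] W])
  show "linear_map K (free_module K (PT c d)) (free_module K (PT (a @ c @ b) (a @ e @ b)))
      (\<lambda>f. comp (W a b g) (W a b f))"
    by (rule linear_map_comp[OF W comp_right[OF W_closed[OF g]]])
qed (simp add: W_basis K.bilinear_extension_basis)

lemma W_W:
  assumes "a \<in> verts Q" and "b \<in> verts Q" and "a' \<in> verts Q" and "b' \<in> verts Q"
    and f: "f \<in> carrier (free_module K (PT c d))"
  shows "W a b (W a' b' f) = W (a @ a') (b' @ b) f"
proof (rule K.linear_map_eqI[OF _ _ _ _ f])
  let ?N = "free_module K (PT (a @ (a' @ c @ b') @ b) (a @ (a' @ d @ b') @ b))"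
  show "Module.module K ?N" by (rule K.free_module_module)
  show "linear_map K (free_module K (PT c d)) ?N (\<lambda>f. W a b (W a' b' f))"
    using linear_map_comp[OF W_linear W_linear] assms by blast
  show "linear_map K (free_module K (PT c d)) ?N (W (a @ a') (b' @ b))"
    using W_linear[of "a @ a'" "b' @ b" c d] assms by (simp add: verts_append)
qed (simp add: W_basis whisker_whisker)

lemma W_Nil_Nil:
  assumes f: "f \<in> carrier (free_module K (PT c d))"
  shows "W [] [] f = f"
proof (rule K.linear_map_eqI[OF K.free_module_module _ _ _ f])
  show "linear_map K (free_module K (PT c d)) (free_module K (PT c d)) (W [] [])"
    using W_linear[of "[]" "[]" c d] by (simp add: verts_Nil)
  show "linear_map K (free_module K (PT c d)) (free_module K (PT c d)) (\<lambda>f. f)"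
    by (rule linear_map_id)
qed (simp add: W_basis whisker_Nil_Nil)

lemma path_tensor_PT:
  assumes "a \<in> verts Q" and "d \<in> verts Q" and "p \<in> PT a b" and "q \<in> PT c d"
  shows "path_tensor a d p q \<in> PT (a @ c) (b @ d)"
  using append_PT[of "whisker [] d p" "a @ d" "b @ d" "whisker a [] q" "a @ c"]
    whisker_PT[OF verts_Nil assms(2,3)] whisker_PT[OF assms(1) verts_Nil assms(4)]
  by (simp add: path_tensor_def)

lemmas tensor_left = K.bilinear_extension_linear_left[where m = "path_tensor a d" for a d, OF _ path_tensor_PT]
lemmas tensor_right = K.bilinear_extension_linear_right[where m = "path_tensor a d" for a d, OF _ path_tensor_PT]

text \<open>
  Tensoring is expressed by whiskering and composition. This holds before passing to the quotient
  because the tensor product of paths is defined in this way; composing in the opposite order gives,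
  in general, the same morphism only modulo the interchange relations.
\<close>

lemma tensor_eq_comp:
  assumes a: "a \<in> verts Q" and d: "d \<in> verts Q"
    and f: "f \<in> carrier (free_module K (PT a b))" and g: "g \<in> carrier (free_module K (PT c d))"
  shows "bilinear_extension K (path_tensor a d) f g = comp (W [] d f) (W a [] g)"
proof (rule linear_map_eq_on_two[OF _ _ _ _ _ _ f g,
      where \<phi> = "bilinear_extension K (path_tensor a d)" and \<psi> = "\<lambda>f g. comp (W [] d f) (W a [] g)"
        and N = "free_module K (PT (a @ c) (b @ d))"])
  have Wd: "linear_map K (free_module K (PT a b)) (free_module K (PT (a @ d) (b @ d))) (W [] d)"
    using W_linear[OF verts_Nil d, of a b] by simp
  have Wa: "linear_map K (free_module K (PT c d)) (free_module K (PT (a @ c) (a @ d))) (W a [])"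
    using W_linear[OF a verts_Nil, of c d] by simp
  show "Module.module K (free_module K (PT (a @ c) (b @ d)))"
    by (rule K.free_module_module)
  {
    fix g assume g: "g \<in> carrier (free_module K (PT c d))"
    show "linear_map K (free_module K (PT a b)) (free_module K (PT (a @ c) (b @ d)))
        (\<lambda>f. bilinear_extension K (path_tensor a d) f g)"
      by (rule tensor_left[OF g a d])
    show "linear_map K (free_module K (PT a b)) (free_module K (PT (a @ c) (b @ d)))
        (\<lambda>f. comp (W [] d f) (W a [] g))"
      by (rule linear_map_comp[OF Wd comp_left[OF linear_mapD(1)[OF Wa g]]])
  next
    fix f assume f: "f \<in> carrier (free_module K (PT a b))"
    show "linear_map K (free_module K (PT c d)) (free_module K (PT (a @ c) (b @ d)))
        (bilinear_extension K (path_tensor a d) f)"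
      by (rule tensor_right[OF f a d])
    show "linear_map K (free_module K (PT c d)) (free_module K (PT (a @ c) (b @ d)))
        (\<lambda>g. comp (W [] d f) (W a [] g))"
      by (rule linear_map_comp[OF Wa comp_right[OF linear_mapD(1)[OF Wd f]]])
  }
qed (simp add: W_basis K.bilinear_extension_basis path_tensor_def)

declare bar_quiver_simps(1) [simp]


section \<open>Ideals stable under whiskering\<close>

text \<open>
  Stability is required of the set itself and not of the ideal generated by it, since the two sets
  of relations at hand satisfy this stronger and easily checked property.
\<close>

definition whisker_stable ::
  "('x list \<times> 'x list \<times> (('x list \<times> 'e \<times> 'x list) list \<Rightarrow> 'k)) set \<Rightarrow> bool" where
  "whisker_stable S \<longleftrightarrow> S \<subseteq> mors L \<and>
    (\<forall>(c, d, f)\<in>S. \<forall>a\<in>verts Q. \<forall>b\<in>verts Q. (a @ c @ b, a @ d @ b, W a b f) \<in> S)"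

lemma whisker_stableD:
  assumes "whisker_stable S"
  shows "S \<subseteq> mors L"
    and "\<lbrakk>(c, d, f) \<in> S; a \<in> verts Q; b \<in> verts Q\<rbrakk> \<Longrightarrow> (a @ c @ b, a @ d @ b, W a b f) \<in> S"
  using assms by (auto simp: whisker_stable_def)

abbreviation ideal where "ideal \<equiv> generated_ideal K L"

lemma ideal_is_ideal: "whisker_stable S \<Longrightarrow> cat_ideal K L (ideal S)"
  by (rule generated_ideal_is_ideal[OF L.linear_category_axioms whisker_stableD(1)])

text \<open>
  The morphisms all of whose whiskerings lie in the ideal generated by \<open>S\<close> form an ideal, because
  whiskering is linear and respects composition, and this ideal contains \<open>S\<close>.
\<close>

lemma W_ideal:
  assumes S: "whisker_stable S" and ab: "a \<in> verts Q" "b \<in> verts Q"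
    and f: "f \<in> ideal S c d"
  shows "W a b f \<in> ideal S (a @ c @ b) (a @ d @ b)"
proof -
  let ?V = "verts Q \<times> verts Q"
  let ?I = "\<lambda>c d. \<Inter>(a, b)\<in>?V. {f \<in> carrier (free_module K (PT c d)).
    W a b f \<in> ideal S (a @ c @ b) (a @ d @ b)}"
  note I = cat_idealD[OF ideal_is_ideal[OF S], simplified, unfolded bar_quiver_simps]
  have mem: "f \<in> ?I c d \<longleftrightarrow> f \<in> carrier (free_module K (PT c d)) \<and>
      (\<forall>a\<in>verts Q. \<forall>b\<in>verts Q. W a b f \<in> ideal S (a @ c @ b) (a @ d @ b))" for f c d
    using verts_Nil by auto
  have closed: "W a b f \<in> carrier (free_module K (PT (a @ c @ b) (a @ d @ b)))"
    if "a \<in> verts Q" "b \<in> verts Q" "f \<in> carrier (free_module K (PT c d))" for a b c d f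
    using linear_mapD(1)[OF W_linear] that by blast
  have "cat_ideal K L ?I"
  proof (rule cat_idealI, unfold free_lincat_simps bar_quiver_simps)
    fix c d assume cd: "c \<in> verts Q" "d \<in> verts Q"
    show "submodule (?I c d) K (free_module K (PT c d))"
    proof (rule submodule_Inter[OF K.free_module_module])
      show "(\<lambda>(a, b). {f \<in> carrier (free_module K (PT c d)).
          W a b f \<in> ideal S (a @ c @ b) (a @ d @ b)}) ` ?V \<noteq> {}"
        using verts_Nil by auto
      fix N assume "N \<in> (\<lambda>(a, b). {f \<in> carrier (free_module K (PT c d)).
          W a b f \<in> ideal S (a @ c @ b) (a @ d @ b)}) ` ?V"
      then obtain a b where ab: "a \<in> verts Q" "b \<in> verts Q"
        and N: "N = {f \<in> carrier (free_module K (PT c d)).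
          W a b f \<in> ideal S (a @ c @ b) (a @ d @ b)}" by blast
      show "submodule N K (free_module K (PT c d))"
        unfolding N using ab cd
        by (intro submodule_preimage[OF K.free_module_module K.free_module_module W_linear] I(1))
          (auto simp: verts_append)
    qed
  next
    fix c d e f g assume "c \<in> verts Q" "d \<in> verts Q" "e \<in> verts Q"
      "f \<in> ?I c d" "f \<in> carrier (free_module K (PT c d))" "g \<in> carrier (free_module K (PT d e))"
    then show "comp g f \<in> ?I c e"
      using I(2)[of "a @ c @ b" "a @ d @ b" "a @ e @ b" "W a b f" "W a b g" for a b]
        L.comp_closed[of c d f e g]
      unfolding mem by (simp add: W_comp closed verts_append bar_quiver_simps)
  next
    fix c d e f g assume "c \<in> verts Q" "d \<in> verts Q" "e \<in> verts Q"
      "f \<in> carrier (free_module K (PT c d))" "g \<in> ?I d e" "g \<in> carrier (free_module K (PT d e))"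
    then show "comp g f \<in> ?I c e"
      using I(3)[of "a @ c @ b" "a @ d @ b" "a @ e @ b" "W a b f" "W a b g" for a b]
        L.comp_closed[of c d f e g]
      unfolding mem by (simp add: W_comp closed verts_append bar_quiver_simps)
  qed
  moreover have "f \<in> ?I c d" if "(c, d, f) \<in> S" for c d f
  proof -
    have "(c, d, f) \<in> mors L" using that whisker_stableD(1)[OF S] by blast
    then have "f \<in> carrier (free_module K (PT c d))" by simp
    moreover have "W a b f \<in> ideal S (a @ c @ b) (a @ d @ b)" if "a \<in> verts Q" "b \<in> verts Q" for a b
      using whisker_stableD(2)[OF S \<open>(c, d, f) \<in> S\<close> that] by (rule generated_ideal_incl)
    ultimately show ?thesis unfolding mem by blast
  qed
  ultimately have "ideal S c d \<subseteq> ?I c d"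
    by (rule generated_ideal_least)
  with f have "f \<in> ?I c d" by (rule subsetD[rotated])
  then show ?thesis using ab unfolding mem by blast
qed

text \<open>
  By \<open>tensor_eq_comp\<close>, a tensor product is a composite of whiskerings of its factors.
\<close>

lemma tensor_ideal_stable:
  assumes S: "whisker_stable S" and verts: "a \<in> verts Q" "b \<in> verts Q" "c \<in> verts Q" "d \<in> verts Q"
    and f: "f \<in> carrier (free_module K (PT a b))" and g: "g \<in> carrier (free_module K (PT c d))"
    and fg: "f \<in> ideal S a b \<or> g \<in> ideal S c d"
  shows "bilinear_extension K (path_tensor a d) f g \<in> ideal S (a @ c) (b @ d)"
proof -
  note I = cat_idealD[OF ideal_is_ideal[OF S], simplified, unfolded bar_quiver_simps]
  have closed: "W [] d f \<in> carrier (free_module K (PT (a @ d) (b @ d)))"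
    "W a [] g \<in> carrier (free_module K (PT (a @ c) (a @ d)))"
    using linear_mapD(1)[OF W_linear[OF verts_Nil verts(4), of a b] f]
      linear_mapD(1)[OF W_linear[OF verts(1) verts_Nil, of c d] g] by simp_all
  have "W [] d f \<in> ideal S (a @ d) (b @ d) \<or> W a [] g \<in> ideal S (a @ c) (a @ d)"
    using fg W_ideal[OF S verts_Nil verts(4), of f a b] W_ideal[OF S verts(1) verts_Nil, of g c d]
    by auto
  then have "comp (W [] d f) (W a [] g) \<in> ideal S (a @ c) (b @ d)"
    using I(2,3)[of "a @ c" "a @ d" "b @ d"] closed verts by (auto simp: verts_append)
  then show ?thesis
    using tensor_eq_comp[OF verts(1,4) f g] by simp
qed

lemma interchange_eq:
  "interchange K Q = {(v @ tail Q e @ w @ v' @ tail Q e' @ w', v @ head Q e @ w @ v' @ head Q e' @ w',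
      basis_elt K [(v @ tail Q e @ w @ v', e', w'), (v, e, w @ v' @ head Q e' @ w')]
        \<ominus>\<^bsub>Hom L (v @ tail Q e @ w @ v' @ tail Q e' @ w') (v @ head Q e @ w @ v' @ head Q e' @ w')\<^esub>
      basis_elt K [(v, e, w @ v' @ tail Q e' @ w'), (v @ head Q e @ w @ v', e', w')])
     | v w v' w' e e'. v \<in> verts Q \<and> w \<in> verts Q \<and> v' \<in> verts Q \<and> w' \<in> verts Q \<and>
       e \<in> arcs Q \<and> e' \<in> arcs Q}"
  unfolding interchange_def by auto

text \<open>
  Whiskering by \<open>a\<close> and \<open>b\<close> replaces the outer words \<open>v\<close> and \<open>w'\<close> of an interchange relation
  by \<open>a @ v\<close> and \<open>w' @ b\<close>; the inner words \<open>w\<close> and \<open>v'\<close> stay.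
\<close>

lemma whisker_stable_interchange: "whisker_stable (interchange K Q)"
proof -
  {
    fix v w v' w' e e'
    assume *: "v \<in> verts Q" "w \<in> verts Q" "v' \<in> verts Q" "w' \<in> verts Q" "e \<in> arcs Q" "e' \<in> arcs Q"
    let ?p = "[(v @ tail Q e @ w @ v', e', w'), (v, e, w @ v' @ head Q e' @ w')]"
    let ?q = "[(v, e, w @ v' @ tail Q e' @ w'), (v @ head Q e @ w @ v', e', w')]"
    let ?a = "v @ tail Q e @ w @ v' @ tail Q e' @ w'"
    let ?b = "v @ head Q e @ w @ v' @ head Q e' @ w'"
    let ?r = "basis_elt K ?p \<ominus>\<^bsub>Hom L ?a ?b\<^esub> basis_elt K ?q"
    have ends: "?a \<in> verts Q" "?b \<in> verts Q"
      using * by (auto simp: verts_append)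
    have p: "basis_elt K ?p \<in> carrier (free_module K (PT ?a ?b))"
      and q: "basis_elt K ?q \<in> carrier (free_module K (PT ?a ?b))"
      using * ends by (auto intro!: K.basis_in_free_module simp: Cons_PT Nil_PT verts_append)
    have "?r \<in> carrier (free_module K (PT ?a ?b))"
      using p q abelian_group.minus_closed[OF Module.module.axioms(2)[OF K.free_module_module]] by simp
    then have "(?a, ?b, ?r) \<in> mors L"
      using ends by (simp add: bar_quiver_simps)
    moreover have "(a @ ?a @ b, a @ ?b @ b, W a b ?r) \<in> interchange K Q"
      if "a \<in> verts Q" "b \<in> verts Q" for a b
    proof -
      have "W a b ?r = basis_elt K (whisker a b ?p)
          \<ominus>\<^bsub>Hom L (a @ ?a @ b) (a @ ?b @ b)\<^esub> basis_elt K (whisker a b ?q)"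
        using linear_map_minus[OF K.free_module_module K.free_module_module W_linear[OF that] p q]
        by (simp add: W_basis)
      then show ?thesis
        unfolding interchange_eq using * that
        by (intro CollectI exI[of _ "a @ v"] exI[of _ w] exI[of _ v'] exI[of _ "w' @ b"]
            exI[of _ e] exI[of _ e']) (simp add: verts_append)
    qed
    ultimately have "(?a, ?b, ?r) \<in> mors L \<and> (\<forall>a\<in>verts Q. \<forall>b\<in>verts Q.
        (a @ ?a @ b, a @ ?b @ b, W a b ?r) \<in> interchange K Q)" by blast
  }
  note * = this
  show ?thesis
    unfolding whisker_stable_def
  proof (intro conjI subsetI ballI, goal_cases)
    case (1 x)
    then show ?case by (subst (asm) interchange_eq) (use * in blast)
  next
    case (2 x)
    then show ?case by (subst (asm) interchange_eq) (use * in blast)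
  qed
qed

abbreviation whisker_combination where
  "whisker_combination a b t \<equiv> map (\<lambda>(k, p). (k, whisker a b p)) t"

lemma combination_closed:
  assumes "is_combination K (bar_quiver Q) c d t"
  shows "combination K (bar_quiver Q) c d t \<in> carrier (free_module K (PT c d))"
proof -
  interpret M: Module.module K "free_module K (PT c d)" by (rule K.free_module_module)
  show ?thesis
    unfolding combination_def free_lincat_simps
  proof (intro M.finsum_closed funcsetI M.smult_closed K.basis_in_free_module)
    fix i assume "i \<in> {..<length t}"
    then have "t ! i \<in> set t" by simp
    then show "fst (t ! i) \<in> carrier K" "snd (t ! i) \<in> PT c d"
      using assms unfolding is_combination_def by fastforce+
  qed
qed

lemma W_combination:
  assumes t: "is_combination K (bar_quiver Q) c d t" and ab: "a \<in> verts Q" "b \<in> verts Q"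
  shows "W a b (combination K (bar_quiver Q) c d t)
    = combination K (bar_quiver Q) (a @ c @ b) (a @ d @ b) (whisker_combination a b t)"
proof -
  interpret M: Module.module K "free_module K (PT c d)" by (rule K.free_module_module)
  interpret N: Module.module K "free_module K (PT (a @ c @ b) (a @ d @ b))" by (rule K.free_module_module)
  have t': "fst (t ! i) \<in> carrier K" "snd (t ! i) \<in> PT c d" if "i < length t" for i
    using t nth_mem[OF that] unfolding is_combination_def by fastforce+
  let ?M = "free_module K (PT c d)" and ?N = "free_module K (PT (a @ c @ b) (a @ d @ b))"
  have "W a b (combination K (bar_quiver Q) c d t)
      = (\<Oplus>\<^bsub>?N\<^esub>i\<in>{..<length t}. W a b (fst (t ! i) \<odot>\<^bsub>?M\<^esub> basis_elt K (snd (t ! i))))"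
    unfolding combination_def free_lincat_simps
    by (intro linear_map_finsum[OF K.free_module_module K.free_module_module W_linear[OF ab]])
      (auto intro!: M.smult_closed K.basis_in_free_module t')
  also have "\<dots> = (\<Oplus>\<^bsub>?N\<^esub>i\<in>{..<length t}.
      fst (whisker_combination a b t ! i) \<odot>\<^bsub>?N\<^esub> basis_elt K (snd (whisker_combination a b t ! i)))"
  proof (rule N.finsum_cong'[OF refl])
    show "(\<lambda>i. fst (whisker_combination a b t ! i) \<odot>\<^bsub>?N\<^esub> basis_elt K (snd (whisker_combination a b t ! i)))
        \<in> {..<length t} \<rightarrow> carrier ?N"
      by (auto simp: case_prod_beta intro!: N.smult_closed K.basis_in_free_module whisker_PT ab t')
    fix i assume "i \<in> {..<length t}"
    then have i: "i < length t" by simp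
    show "W a b (fst (t ! i) \<odot>\<^bsub>?M\<^esub> basis_elt K (snd (t ! i)))
        = fst (whisker_combination a b t ! i) \<odot>\<^bsub>?N\<^esub> basis_elt K (snd (whisker_combination a b t ! i))"
      using linear_mapD(3)[OF W_linear[OF ab] t'(1)[OF i] K.basis_in_free_module[OF t'(2)[OF i]]] i
      by (simp add: W_basis case_prod_beta)
  qed
  finally show ?thesis
    by (simp add: combination_def)
qed

end


section \<open>The presentation\<close>

locale monoidal_relations = free_monoid_quiver K Q X
  for K :: "('k, 'r) ring_scheme" and Q :: "('x list, 'e) pre_digraph" and X :: "'x set" +
  fixes R :: "('x list \<times> 'x list \<times> (('x list \<times> 'e \<times> 'x list) list \<Rightarrow> 'k) set) set"
    and rep :: "'x list \<times> 'x list \<times> (('x list \<times> 'e \<times> 'x list) list \<Rightarrow> 'k) set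
      \<Rightarrow> ('k \<times> ('x list \<times> 'e \<times> 'x list) list) list"
  assumes R_mors: "R \<subseteq> mors (free_monoidal K Q)"
    and rep: "\<And>a b \<rho>. (a, b, \<rho>) \<in> R \<Longrightarrow> expresses K Q a b (rep (a, b, \<rho>)) \<rho>"
begin

abbreviation I where "I \<equiv> interchange_ideal K Q"
abbreviation LI where "LI \<equiv> quotient_category L I"
abbreviation FM where "FM \<equiv> free_monoidal K Q"
abbreviation J where "J \<equiv> generated_tensor_ideal K FM R"
abbreviation relations where "relations \<equiv> interchange K Q \<union> whiskered_relations K Q R rep"
abbreviation P where "P \<equiv> ideal relations"

sublocale I: category_ideal K L I
  by unfold_locales (rule ideal_is_ideal[OF whisker_stable_interchange])

lemma FM_simps [simp]:
  "Ob FM = verts Q" "Hom FM = Hom LI" "Comp FM = Comp LI" "Ident FM = Ident LI" "TensOb FM = (@)"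
  "Tens FM a b c d F G = (\<Union>f\<in>F. \<Union>g\<in>G. I.coset (a @ c) (b @ d) (bilinear_extension K (path_tensor a d) f g))"
  by (simp_all add: free_monoidal_def quotient_monoidal_def quotient_category_def free_pre_monoidal_def
      bar_quiver_simps)

lemma mors_L: "(a, b, f) \<in> mors L \<longleftrightarrow> a \<in> verts Q \<and> b \<in> verts Q \<and> f \<in> carrier (free_module K (PT a b))"
  by (simp add: bar_quiver_simps)

lemma mors_FM: "mors FM = mors LI"
  by (simp add: mors_def bar_quiver_simps)

lemma cat_ideal_FM: "cat_ideal K FM = cat_ideal K LI"
  by (simp add: cat_ideal_def fun_eq_iff bar_quiver_simps)

lemma linear_category_FM: "linear_category K FM"
proof -
  have "linear_category K FM \<longleftrightarrow> linear_category K LI"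
    unfolding linear_category_def mors_FM by (simp add: bar_quiver_simps)
  then show ?thesis using I.linear_category_quotient by simp
qed

lemma Hom_FM:
  "\<lbrakk>a \<in> verts Q; b \<in> verts Q\<rbrakk> \<Longrightarrow> carrier (Hom FM a b) = I.coset a b ` carrier (free_module K (PT a b))"
  using I.Hom_quotient[of a b] by (simp add: bar_quiver_simps)

text \<open>
  The tensor product of classes does not depend on representatives, because the interchange ideal
  is closed under tensoring with arbitrary morphisms of \<open>L\<close>.
\<close>

lemma Tens_FM:
  assumes f: "(a, b, f) \<in> mors L" and g: "(c, d, g) \<in> mors L"
  shows "Tens FM a b c d (I.coset a b f) (I.coset c d g)
    = I.coset (a @ c) (b @ d) (bilinear_extension K (path_tensor a d) f g)"
proof -
  have *: "a \<in> verts Q" "b \<in> verts Q" "c \<in> verts Q" "d \<in> verts Q"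
    using f g by (simp_all add: mors_L)
  have sub: "I a b \<subseteq> carrier (free_module K (PT a b))" "I c d \<subseteq> carrier (free_module K (PT c d))"
    using I.ideal_subset[of a b] I.ideal_subset[of c d] * by (simp_all add: bar_quiver_simps)
  show ?thesis
    unfolding FM_simps
  proof (rule coset_biadditive[where K = K])
    show "module_submodule K (Hom L a b) (I a b)" "module_submodule K (Hom L c d) (I c d)"
      "module_submodule K (Hom L (a @ c) (b @ d)) (I (a @ c) (b @ d))"
      by (rule I.module_submodule; simp add: * verts_append)+
  next
    fix f g assume "f \<in> I a b" "g \<in> carrier (Hom L c d)"
    then show "bilinear_extension K (path_tensor a d) f g \<in> I (a @ c) (b @ d)"
      using sub * by (intro tensor_ideal_stable[OF whisker_stable_interchange]) auto
  next
    fix f g assume "f \<in> carrier (Hom L a b)" "g \<in> I c d"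
    then show "bilinear_extension K (path_tensor a d) f g \<in> I (a @ c) (b @ d)"
      using sub * by (intro tensor_ideal_stable[OF whisker_stable_interchange]) auto
  next
    fix f g assume "f \<in> carrier (Hom L a b)" "g \<in> carrier (Hom L c d)"
    then show "bilinear_extension K (path_tensor a d) f g \<in> carrier (Hom L (a @ c) (b @ d))"
      using linear_mapD(1)[OF tensor_left[OF _ *(1,4)]] by simp
  next
    fix f f' g assume f: "f \<in> carrier (Hom L a b)" and f': "f' \<in> carrier (Hom L a b)"
      and g: "g \<in> carrier (Hom L c d)"
    show "bilinear_extension K (path_tensor a d) (f \<oplus>\<^bsub>Hom L a b\<^esub> f') g
        = bilinear_extension K (path_tensor a d) f g \<oplus>\<^bsub>Hom L (a @ c) (b @ d)\<^esub>
          bilinear_extension K (path_tensor a d) f' g"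
      using linear_mapD(2)[OF tensor_left[OF g[simplified] *(1,4)] f[simplified] f'[simplified]] by simp
  next
    fix f g g' assume f: "f \<in> carrier (Hom L a b)" and g: "g \<in> carrier (Hom L c d)"
      and g': "g' \<in> carrier (Hom L c d)"
    show "bilinear_extension K (path_tensor a d) f (g \<oplus>\<^bsub>Hom L c d\<^esub> g')
        = bilinear_extension K (path_tensor a d) f g \<oplus>\<^bsub>Hom L (a @ c) (b @ d)\<^esub>
          bilinear_extension K (path_tensor a d) f g'"
      using linear_mapD(2)[OF tensor_right[OF f[simplified] *(1,4)] g[simplified] g'[simplified]] by simp
  qed (use f g in \<open>simp_all add: mors_L\<close>)
qed

lemma tensor_ideal_J: "tensor_ideal K FM J"
proof (rule tensor_ideal_generated[OF linear_category_FM R_mors])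
  fix a b c d F G assume FG: "(a, b, F) \<in> mors FM" "(c, d, G) \<in> mors FM"
  then have *: "a \<in> verts Q" "b \<in> verts Q" "c \<in> verts Q" "d \<in> verts Q" by simp_all
  obtain f where f: "(a, b, f) \<in> mors L" "F = I.coset a b f"
    using FG(1) Hom_FM[OF *(1,2)] by (auto simp: mors_L)
  obtain g where g: "(c, d, g) \<in> mors L" "G = I.coset c d g"
    using FG(2) Hom_FM[OF *(3,4)] by (auto simp: mors_L)
  show "Tens FM a b c d F G \<in> carrier (Hom FM (TensOb FM a c) (TensOb FM b d))"
    using linear_mapD(1)[OF tensor_left[OF conjunct2[OF conjunct2[OF g(1)[unfolded mors_L]]] *(1,4)]] f(1) *
    unfolding f(2) g(2) Tens_FM[OF f(1) g(1)]
    by (simp del: FM_simps(2,6) add: Hom_FM verts_append)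
qed

lemma cat_ideal_J: "cat_ideal K LI J"
  using tensor_ideal_J by (simp add: tensor_ideal_def cat_ideal_FM)

lemma relation:
  assumes "(c, d, \<rho>) \<in> R"
  shows "c \<in> verts Q" and "d \<in> verts Q"
    and "is_combination K (bar_quiver Q) c d (rep (c, d, \<rho>))"
    and "\<rho> = I.coset c d (combination K (bar_quiver Q) c d (rep (c, d, \<rho>)))"
  using rep[OF assms] R_mors assms by (auto simp: expresses_def mors_def)

text \<open>
  The relations \<open>r\<^bsub>a,b\<^esub>\<close>, which are defined term by term, are the whiskerings of the chosen
  representatives \<open>r\<close>.
\<close>

lemma whiskered_relationsE:
  assumes "(c', d', f) \<in> whiskered_relations K Q R rep"
  obtains a b c d \<rho> where "a \<in> verts Q" "b \<in> verts Q" "(c, d, \<rho>) \<in> R"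
    "c' = a @ c @ b" "d' = a @ d @ b"
    "f = W a b (combination K (bar_quiver Q) c d (rep (c, d, \<rho>)))"
  using assms W_combination[OF relation(3)] by (auto simp: whiskered_relations_def)

lemma whiskered_relationsI:
  assumes "a \<in> verts Q" "b \<in> verts Q" "(c, d, \<rho>) \<in> R"
  shows "(a @ c @ b, a @ d @ b, W a b (combination K (bar_quiver Q) c d (rep (c, d, \<rho>))))
    \<in> whiskered_relations K Q R rep"
  unfolding whiskered_relations_def W_combination[OF relation(3)[OF assms(3)] assms(1,2)]
  using assms by blast

text \<open>
  Whiskering twice is whiskering once by the concatenated words.
\<close>

lemma whisker_stable_whiskered_relations: "whisker_stable (whiskered_relations K Q R rep)"
proof -
  have 1: "(c', d', f) \<in> mors L" if "(c', d', f) \<in> whiskered_relations K Q R rep" for c' d' f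
    using that
  proof (rule whiskered_relationsE)
    fix a b c d \<rho> assume *: "a \<in> verts Q" "b \<in> verts Q" "(c, d, \<rho>) \<in> R"
      "c' = a @ c @ b" "d' = a @ d @ b" "f = W a b (combination K (bar_quiver Q) c d (rep (c, d, \<rho>)))"
    then show ?thesis
      using relation(1,2)[OF *(3)] linear_mapD(1)[OF W_linear[OF *(1,2)] combination_closed[OF relation(3)[OF *(3)]]]
      by (simp add: bar_quiver_simps verts_append)
  qed
  have 2: "(x @ c' @ y, x @ d' @ y, W x y f) \<in> whiskered_relations K Q R rep"
    if f: "(c', d', f) \<in> whiskered_relations K Q R rep" and xy: "x \<in> verts Q" "y \<in> verts Q" for c' d' f x y
    using f
  proof (rule whiskered_relationsE)
    fix a b c d \<rho> assume *: "a \<in> verts Q" "b \<in> verts Q" "(c, d, \<rho>) \<in> R"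
      "c' = a @ c @ b" "d' = a @ d @ b" "f = W a b (combination K (bar_quiver Q) c d (rep (c, d, \<rho>)))"
    then show ?thesis
      using whiskered_relationsI[of "x @ a" "b @ y" c d \<rho>] xy
        W_W[OF xy *(1,2) combination_closed[OF relation(3)[OF *(3)]]]
      by (simp add: verts_append)
  qed
  show ?thesis unfolding whisker_stable_def using 1 2 by fast
qed

lemma whisker_stable_relations: "whisker_stable relations"
  using whisker_stable_interchange whisker_stable_whiskered_relations
  by (auto simp: whisker_stable_def)

lemma I_subset_P: "I a b \<subseteq> P a b"
  by (rule generated_ideal_least[OF ideal_is_ideal[OF whisker_stable_relations]])
    (auto intro: generated_ideal_incl)

sublocale P: category_ideal K L P
  by unfold_locales (rule ideal_is_ideal[OF whisker_stable_relations])

text \<open>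
  On classes, whiskering is \<open>1\<^sub>a \<otimes> (f \<otimes> 1\<^sub>b)\<close>, and tensor ideals absorb both tensor products.
\<close>

lemma J_whisker:
  assumes ab: "a \<in> verts Q" "b \<in> verts Q" and f: "(c, d, f) \<in> mors L" and J: "I.coset c d f \<in> J c d"
  shows "I.coset (a @ c @ b) (a @ d @ b) (W a b f) \<in> J (a @ c @ b) (a @ d @ b)"
proof -
  have cd: "c \<in> verts Q" "d \<in> verts Q" and fc: "f \<in> carrier (free_module K (PT c d))"
    using f by (simp_all add: mors_L)
  have J_tens: "Tens FM a b c d F G \<in> J (a @ c) (b @ d)"
    if "a \<in> verts Q" "b \<in> verts Q" "c \<in> verts Q" "d \<in> verts Q"
      "F \<in> carrier (Hom FM a b)" "G \<in> carrier (Hom FM c d)" "F \<in> J a b \<or> G \<in> J c d" for a b c d F G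
    using tensor_ideal_J that unfolding tensor_ideal_def FM_simps(1,5) by blast
  have one: "(a, a, basis_elt K []) \<in> mors L" if "a \<in> verts Q" for a
    using that by (simp add: mors_L K.basis_in_free_module Nil_PT)
  have Wf: "W [] b f \<in> carrier (free_module K (PT (c @ b) (d @ b)))"
    using linear_mapD(1)[OF W_linear[OF verts_Nil ab(2), of c d] fc] by simp
  have id: "W x y (basis_elt K []) = basis_elt K []" for x y
    by (simp add: W_basis)
  \<comment> \<open>By \<open>tensor_eq_comp\<close>, tensoring with an identity is whiskering on one side, as the other
    factor of the composite is an identity.\<close>
  have fb: "bilinear_extension K (path_tensor c b) f (basis_elt K []) = W [] b f"
    using tensor_eq_comp[OF cd(1) ab(2) fc, of "basis_elt K []" b] one[OF ab(2)]
      L.comp_ident_right[of "c @ b" "d @ b" "W [] b f"] Wf cd ab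
    by (simp add: id mors_L bar_quiver_simps verts_append)
  have af: "bilinear_extension K (path_tensor a (d @ b)) (basis_elt K []) (W [] b f) = W a b f"
    using tensor_eq_comp[of a "d @ b" "basis_elt K []" a "W [] b f" "c @ b"] one[OF ab(1)] Wf cd ab
      L.comp_ident_left[of "a @ c @ b" "a @ d @ b" "W a b f"]
      W_W[OF ab(1) verts_Nil verts_Nil ab(2) fc] linear_mapD(1)[OF W_linear[OF ab, of c d] fc]
    by (simp add: id mors_L bar_quiver_simps verts_append)
  have "Tens FM c d b b (I.coset c d f) (I.coset b b (basis_elt K [])) \<in> J (c @ b) (d @ b)"
    using J cd ab fc one by (intro J_tens) (simp_all del: FM_simps(2,6) add: Hom_FM mors_L)
  then have "I.coset (c @ b) (d @ b) (W [] b f) \<in> J (c @ b) (d @ b)"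
    unfolding Tens_FM[OF f one[OF ab(2)]] fb .
  then have "Tens FM a a (c @ b) (d @ b) (I.coset a a (basis_elt K [])) (I.coset (c @ b) (d @ b) (W [] b f))
      \<in> J (a @ c @ b) (a @ d @ b)"
    using cd ab Wf one by (intro J_tens) (simp_all del: FM_simps(2,6) add: Hom_FM mors_L verts_append)
  moreover have "(c @ b, d @ b, W [] b f) \<in> mors L"
    using Wf cd ab by (simp add: mors_L verts_append)
  ultimately show ?thesis
    using Tens_FM[OF one[OF ab(1)], of "c @ b" "d @ b" "W [] b f"] af by simp
qed

text \<open>
  The preimage of \<open>J\<close> is an ideal of \<open>L\<close>. It contains the generators of \<open>P\<close>: the class of an
  interchange relation is zero, and the class of \<open>r\<^bsub>a,b\<^esub>\<close> is a whiskering of an element of \<open>R\<close>.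
\<close>

lemma P_imp_J:
  assumes "f \<in> P a b"
  shows "I.coset a b f \<in> J a b"
proof -
  let ?P = "\<lambda>a b. {f \<in> carrier (Hom L a b). I.coset a b f \<in> J a b}"
  have "cat_ideal K L ?P"
  proof (rule cat_idealI)
    show "submodule (?P a b) K (Hom L a b)" if "a \<in> Ob L" "b \<in> Ob L" for a b
      using that cat_idealD(1)[OF cat_ideal_J, of a b]
      by (intro submodule_preimage[OF L.hom_module I.module_Hom_quotient I.coset_linear]) auto
  next
    fix a b c f g assume *: "a \<in> Ob L" "b \<in> Ob L" "c \<in> Ob L" "f \<in> ?P a b"
      "f \<in> carrier (Hom L a b)" "g \<in> carrier (Hom L b c)"
    then have "Comp LI a b c (I.coset b c g) (I.coset a b f) \<in> J a c"
      by (intro cat_idealD(2)[OF cat_ideal_J]) (simp_all only: I.Ob_quotient I.Hom_quotient, auto)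
    then show "Comp L a b c g f \<in> ?P a c"
      using * I.Comp_quotient[of a b f c g] L.comp_closed[of a b f c g] by simp
  next
    fix a b c f g assume *: "a \<in> Ob L" "b \<in> Ob L" "c \<in> Ob L" "f \<in> carrier (Hom L a b)"
      "g \<in> ?P b c" "g \<in> carrier (Hom L b c)"
    then have "Comp LI a b c (I.coset b c g) (I.coset a b f) \<in> J a c"
      by (intro cat_idealD(3)[OF cat_ideal_J]) (simp_all only: I.Ob_quotient I.Hom_quotient, auto)
    then show "Comp L a b c g f \<in> ?P a c"
      using * I.Comp_quotient[of a b f c g] L.comp_closed[of a b f c g] by simp
  qed
  moreover have "f \<in> ?P a b" if "(a, b, f) \<in> relations" for a b f
  proof -
    have f: "(a, b, f) \<in> mors L"
      using that whisker_stableD(1)[OF whisker_stable_relations] by blast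
    then have ab: "a \<in> verts Q" "b \<in> verts Q" by (simp_all add: mors_L)
    have "I.coset a b f \<in> J a b"
      using that
    proof
      assume "(a, b, f) \<in> interchange K Q"
      then have "f \<in> I a b" by (rule generated_ideal_incl)
      then have "I.coset a b f = \<zero>\<^bsub>Hom LI a b\<^esub>"
        using I.coset_in_ideal ab by (simp add: bar_quiver_simps)
      then show ?thesis
        using cat_idealD(1)[OF cat_ideal_J, of a b] ab module_zero_in_submodule
        by (simp add: bar_quiver_simps)
    next
      assume "(a, b, f) \<in> whiskered_relations K Q R rep"
      then show ?thesis
      proof (rule whiskered_relationsE)
        fix x y c d \<rho> assume *: "x \<in> verts Q" "y \<in> verts Q" "(c, d, \<rho>) \<in> R"
          "a = x @ c @ y" "b = x @ d @ y" "f = W x y (combination K (bar_quiver Q) c d (rep (c, d, \<rho>)))"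
        show ?thesis
          unfolding *(4-6)
        proof (rule J_whisker[OF *(1,2)])
          show "(c, d, combination K (bar_quiver Q) c d (rep (c, d, \<rho>))) \<in> mors L"
            using relation(1-3)[OF *(3)] by (simp add: mors_L combination_closed)
          show "I.coset c d (combination K (bar_quiver Q) c d (rep (c, d, \<rho>))) \<in> J c d"
            using relation(4)[OF *(3)] generated_tensor_ideal_incl[OF *(3)] by simp
        qed
      qed
    qed
    with f show ?thesis by (simp add: mors_L)
  qed
  ultimately have "P a b \<subseteq> ?P a b" by (rule generated_ideal_least)
  then show ?thesis using assms by blast
qed

text \<open>
  The image of \<open>P\<close> in the free linear monoidal category absorbs tensor products because the set of
  relations generating \<open>P\<close> is stable under whiskering.
\<close>

lemma tensor_ideal_image: "tensor_ideal K FM (\<lambda>a b. I.coset a b ` P a b)"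
  unfolding tensor_ideal_def
proof (intro conjI ballI impI)
  note subset = P.ideal_subset[simplified, unfolded bar_quiver_simps]
  note P_comp = cat_idealD(2,3)[OF P.ideal]
  show "cat_ideal K FM (\<lambda>a b. I.coset a b ` P a b)"
    unfolding cat_ideal_FM
  proof (rule cat_idealI, unfold I.Ob_quotient)
    show "submodule (I.coset a b ` P a b) K (Hom LI a b)" if "a \<in> Ob L" "b \<in> Ob L" for a b
      using that cat_idealD(1)[OF P.ideal]
      by (intro submodule_image[OF L.hom_module I.module_Hom_quotient I.coset_linear]) auto
  next
    fix a b c F G assume *: "a \<in> Ob L" "b \<in> Ob L" "c \<in> Ob L" "F \<in> I.coset a b ` P a b"
      "G \<in> carrier (Hom LI b c)"
    obtain f where f: "f \<in> P a b" "F = I.coset a b f" using *(4) by blast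
    obtain g where g: "g \<in> carrier (Hom L b c)" "G = I.coset b c g"
      using *(5) I.Hom_quotient[OF *(2,3)] by blast
    have "f \<in> carrier (Hom L a b)" using f(1) P.ideal_subset[OF *(1,2)] by blast
    then show "Comp LI a b c G F \<in> I.coset a c ` P a c"
      using * f g I.Comp_quotient[of a b f c g] P_comp(1)[of a b c f g] by simp
  next
    fix a b c F G assume *: "a \<in> Ob L" "b \<in> Ob L" "c \<in> Ob L" "F \<in> carrier (Hom LI a b)"
      "G \<in> I.coset b c ` P b c"
    obtain g where g: "g \<in> P b c" "G = I.coset b c g" using *(5) by blast
    obtain f where f: "f \<in> carrier (Hom L a b)" "F = I.coset a b f"
      using *(4) I.Hom_quotient[OF *(1,2)] by blast
    have "g \<in> carrier (Hom L b c)" using g(1) P.ideal_subset[OF *(2,3)] by blast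
    then show "Comp LI a b c G F \<in> I.coset a c ` P a c"
      using * f g I.Comp_quotient[of a b f c g] P_comp(2)[of a b c f g] by simp
  qed
  fix a b c d F G assume "a \<in> Ob FM" "b \<in> Ob FM" "c \<in> Ob FM" "d \<in> Ob FM"
    and F: "F \<in> carrier (Hom FM a b)" and G: "G \<in> carrier (Hom FM c d)"
    and FG: "F \<in> I.coset a b ` P a b \<or> G \<in> I.coset c d ` P c d"
  then have *: "a \<in> verts Q" "b \<in> verts Q" "c \<in> verts Q" "d \<in> verts Q" by simp_all
  \<comment> \<open>Representatives are chosen in \<open>P\<close> whenever the coset has one there.\<close>
  obtain f g where f: "(a, b, f) \<in> mors L" "F = I.coset a b f"
    and g: "(c, d, g) \<in> mors L" "G = I.coset c d g" and fg: "f \<in> P a b \<or> g \<in> P c d"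
  proof -
    obtain f where f: "f \<in> carrier (free_module K (PT a b))" "F = I.coset a b f"
        "F \<in> I.coset a b ` P a b \<Longrightarrow> f \<in> P a b"
      using F subset[OF *(1,2)] unfolding Hom_FM[OF *(1,2)] by blast
    obtain g where g: "g \<in> carrier (free_module K (PT c d))" "G = I.coset c d g"
        "G \<in> I.coset c d ` P c d \<Longrightarrow> g \<in> P c d"
      using G subset[OF *(3,4)] unfolding Hom_FM[OF *(3,4)] by blast
    show thesis
      using that[of f g] f g FG * unfolding mors_L by blast
  qed
  show "Tens FM a b c d F G \<in> I.coset (TensOb FM a c) (TensOb FM b d) ` P (TensOb FM a c) (TensOb FM b d)"
    unfolding f(2) g(2) Tens_FM[OF f(1) g(1)] FM_simps(5)
    using f(1) g(1) fg * by (intro imageI tensor_ideal_stable[OF whisker_stable_relations])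
      (simp_all add: mors_L)
qed

text \<open>
  By the minimality of \<open>J\<close>, a morphism \<open>f\<close> whose class lies in \<open>J\<close> is congruent modulo \<open>I\<close>
  to an element of \<open>P\<close>. As \<open>I\<close> is contained in \<open>P\<close>, so is \<open>f\<close> in \<open>P\<close>.
\<close>

lemma J_imp_P:
  assumes f: "(a, b, f) \<in> mors L" and J: "I.coset a b f \<in> J a b"
  shows "f \<in> P a b"
proof -
  have "\<rho> \<in> I.coset c d ` P c d" if "(c, d, \<rho>) \<in> R" for c d \<rho>
  proof -
    let ?r = "combination K (bar_quiver Q) c d (rep (c, d, \<rho>))"
    have "(c, d, ?r) \<in> relations"
      using whiskered_relationsI[OF verts_Nil verts_Nil that]
        W_Nil_Nil[OF combination_closed[OF relation(3)[OF that]]] by simp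
    then have "?r \<in> P c d" by (rule generated_ideal_incl)
    then show ?thesis using relation(4)[OF that] by blast
  qed
  then have "J a b \<subseteq> I.coset a b ` P a b"
    by (rule generated_tensor_ideal_least[OF tensor_ideal_image])
  then obtain g where g: "g \<in> P a b" "I.coset a b f = I.coset a b g"
    using J by blast
  have ab: "a \<in> Ob L" "b \<in> Ob L" using f by simp_all
  have gc: "(a, b, g) \<in> mors L"
    using g(1) P.ideal_subset[OF ab] ab by auto
  have "f \<ominus>\<^bsub>Hom L a b\<^esub> g \<in> P a b"
    using g(2) I.coset_eq_iff[OF f gc] I_subset_P by blast
  then show ?thesis
    using module_submodule.minus_mem_imp_mem[OF P.module_submodule[OF ab]] g(1) f by simp
qed

lemma linearly_isomorphic_relations:
  "linearly_isomorphic K (quotient_category LI J) (quotient_category L P)"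
  using P_imp_J J_imp_P by (intro I.iterated_quotient cat_ideal_J P.ideal) blast

lemma quotient_category_FM: "quotient_category FM J = quotient_category LI J"
  by (simp add: quotient_category_def[of FM] quotient_category_def[of LI] bar_quiver_simps)

end

lemma monoidally_isomorphic_imp_linearly:
  assumes "monoidally_isomorphic K C (quotient_monoidal D I)"
  shows "linearly_isomorphic K C (quotient_category D I)"
proof -
  obtain F \<Phi> where "linear_functor K C (quotient_monoidal D I) F \<Phi>"
    and "bijective_functor C (quotient_monoidal D I) F \<Phi>"
    using assms unfolding monoidally_isomorphic_def linear_monoidal_functor_def by blast
  then have "linear_functor K C (quotient_category D I) F \<Phi>"
    and "bijective_functor C (quotient_category D I) F \<Phi>"
    by (simp_all add: linear_functor_def bijective_functor_def quotient_monoidal_def)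
  then show ?thesis unfolding linearly_isomorphic_def by blast
qed

theorem theorem5p2:
  fixes K :: "('k, 'r) ring_scheme"
    and M :: "('k, 'o, 'm, 'z) lmcat_scheme"
    and X :: "'x set"
    and Q :: "('x list, 'e) pre_digraph"
    and R :: "('x list \<times> 'x list \<times> (('x list \<times> 'e \<times> 'x list) list \<Rightarrow> 'k) set) set"
    and rep :: "'x list \<times> 'x list \<times> (('x list \<times> 'e \<times> 'x list) list \<Rightarrow> 'k) set
      \<Rightarrow> ('k \<times> ('x list \<times> 'e \<times> 'x list) list) list"
  assumes "cring K"
    and "wf_digraph Q" and "verts Q = lists X"
    and "R \<subseteq> mors (free_monoidal K Q)"
    and "linear_monoidal_category K M"
    and "monoidal_presentation K M X Q R"
    and "\<And>a b \<rho>. (a, b, \<rho>) \<in> R \<Longrightarrow> expresses K Q a b (rep (a, b, \<rho>)) \<rho>"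
  shows "linear_presentation K M (bar_quiver Q)
    (interchange K Q \<union> whiskered_relations K Q R rep)"
proof -
  interpret monoidal_relations K Q X R rep
    using assms by (simp add: monoidal_relations_def free_monoid_quiver_def
        free_monoid_quiver_axioms_def monoidal_relations_axioms_def)
  have "monoidally_isomorphic K M (quotient_monoidal FM J)"
    using assms(6) by (simp add: monoidal_presentation_def)
  then have "linearly_isomorphic K M (quotient_category LI J)"
    using monoidally_isomorphic_imp_linearly quotient_category_FM by metis
  then have "linearly_isomorphic K M (quotient_category L P)"
    using linearly_isomorphic_relations by (rule linearly_isomorphic_trans)
  then show ?thesis
    using wf_bar_quiver whisker_stableD(1)[OF whisker_stable_relations]
    by (simp add: linear_presentation_def)
qed

end
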